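(* Let $T$ be a first-order $L$-theory and $\kappa$ a cardinal. If $T$ is $\kappa$-rich then $\mathrm{Mod}(T)$ is bitotally bisimilar with $\mathrm{Mod}_{\kappa^+}(T)$, and thus with a set-sized potentialist system (one having only set-many worlds).
   Context: A potentialist system is a collection (possibly a proper class) of $L$-structures, called worlds, together with a collection of embeddings between them, containing the identity embeddings and closed under composition. "$\pi\colon M\to M'$ in $\mathcal M$" means that $\pi$ is one of the embeddings of $\mathcal M$. Class-sized systems are handled in a class theory such as Morse-Kelley, or using Grothendieck universes. $\mathrm{Mod}(T)$ is the system of all models of $T$ together with exactly the substructure inclusion maps $M\subseteq N$. For a cardinal $\lambda$, $\mathrm{Mod}_\lambda(T)$ is the subsystem of $\mathrm{Mod}(T)$ consisting of the models of cardinality less than $\lambda$ (and the inclusions between them). $T$ is $\kappa$-rich, for a cardinal $\kappa\ge|L|+\aleph_0$, if it has infinite models and all its models of size $\kappa$ are $\aleph_0$-saturated. A bisimulation between potentialist systems $\mathcal M$ and $\mathcal N$ is a non-empty relation $\sim$ matching pairs $(M,\overline a)$ with pairs $(N,\overline b)$, where $M\in\mathcal M$, $N\in\mathcal N$ and $\overline a,\overline b$ are finite tuples of the same length from $M,N$ respectively, such that whenever $(M,\overline a)\sim(N,\overline b)$: (B1) $\overline a$ in $M$ and $\overline b$ in $N$ satisfy the same atomic formulas; (B2) for any $c\in M$ there is $d\in N$ with $(M,\overline a c)\sim(N,\overline b d)$, and vice versa; (B3) for any $\pi\colon M\to M'$ in $\mathcal M$ there is $\rho\colon N\to N'$ in $\mathcal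 N$ with $(M',\pi(\overline a))\sim(N',\rho(\overline b))$, and vice versa. It is bitotal if every pair $(M,\overline a)$ from $\mathcal M$ is related to some pair $(N,\overline b)$ from $\mathcal N$, and conversely every pair $(N,\overline b)$ from $\mathcal N$ is related to some pair from $\mathcal M$. Two systems are bitotally bisimilar if there is a bitotal bisimulation between them. *)

theory Defs
  imports Main "HOL-Library.FuncSet"
begin

unbundle cardinal_syntax

section \<open>First-order languages and structures\<close>

text \<open>
  Languages carry explicit sets of symbols, so that purely relational or purely functional
  languages are included; constants are function symbols of arity 0.
\<close>

record ('f, 'r) lang =
  funs :: "'f set"
  rels :: "'r set"
  farity :: "'f \<Rightarrow> nat"
  rarity :: "'r \<Rightarrow> nat"

record ('f, 'r, 'a) struct =
  carrier :: "'a set"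
  fint :: "'f \<Rightarrow> 'a list \<Rightarrow> 'a"
  rint :: "'r \<Rightarrow> 'a list set"

definition tuples :: "'a set \<Rightarrow> nat \<Rightarrow> 'a list set" where
  "tuples A n = {xs. set xs \<subseteq> A \<and> length xs = n}"

text \<open>
  Proper classes are treated relative to a universe, represented by a type \<open>'u\<close>: the sets of
  the universe are the subsets of \<open>'u\<close> of cardinality less than that of \<open>'u\<close>, and a collection
  of objects is set-sized if it has fewer elements than \<open>'u\<close>. Up to renaming of elements, a
  Grothendieck universe is the case where \<open>'u\<close> has inaccessible cardinality (there, a subset
  of the universe is an element of it iff it has smaller cardinality than the universe). The
  only closure property needed is that, for a given cardinal \<open>\<kappa>\<close>, both \<open>\<kappa>\<close> and \<open>2\<^sup>\<kappa>\<close> are in the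
  universe, i.e. \<open>ctwo ^c \<kappa> <o |UNIV :: 'u set|\<close>; if \<open>'u\<close> has inaccessible cardinality, this holds
  for every \<open>\<kappa>\<close> in the universe.
\<close>

definition small :: "'u set \<Rightarrow> bool" where
  "small A \<longleftrightarrow> |A| <o |UNIV :: 'u set|"

text \<open>
  The interpretations take fixed default values outside their proper domain, so that two
  structures with the same domain and the same interpretations of the symbols of \<open>L\<close> are equal.
\<close>

definition is_struct :: "('f, 'r) lang \<Rightarrow> ('f, 'r, 'u) struct \<Rightarrow> bool" where
  "is_struct L M \<longleftrightarrow>
     carrier M \<noteq> {} \<and> small (carrier M) \<and>
     (\<forall>f xs. if f \<in> funs L \<and> xs \<in> tuples (carrier M) (farity L f)
             then fint M f xs \<in> carrier M else fint M f xs = undefined) \<and>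
     (\<forall>r. if r \<in> rels L then rint M r \<subseteq> tuples (carrier M) (rarity L r) else rint M r = {})"

definition substructure ::
  "('f, 'r) lang \<Rightarrow> ('f, 'r, 'u) struct \<Rightarrow> ('f, 'r, 'u) struct \<Rightarrow> bool" where
  "substructure L M N \<longleftrightarrow>
     is_struct L M \<and> is_struct L N \<and> carrier M \<subseteq> carrier N \<and>
     (\<forall>f \<in> funs L. \<forall>xs \<in> tuples (carrier M) (farity L f). fint M f xs = fint N f xs) \<and>
     (\<forall>r \<in> rels L. rint M r = rint N r \<inter> tuples (carrier M) (rarity L r))"

definition embedding ::
  "('f, 'r) lang \<Rightarrow> ('f, 'r, 'u) struct \<Rightarrow> ('u \<Rightarrow> 'u) \<Rightarrow> ('f, 'r, 'u) struct \<Rightarrow> bool" where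
  "embedding L M \<pi> N \<longleftrightarrow>
     is_struct L M \<and> is_struct L N \<and>
     \<pi> \<in> carrier M \<rightarrow>\<^sub>E carrier N \<and> inj_on \<pi> (carrier M) \<and>
     (\<forall>f \<in> funs L. \<forall>xs \<in> tuples (carrier M) (farity L f).
        \<pi> (fint M f xs) = fint N f (map \<pi> xs)) \<and>
     (\<forall>r \<in> rels L. \<forall>xs \<in> tuples (carrier M) (rarity L r).
        xs \<in> rint M r \<longleftrightarrow> map \<pi> xs \<in> rint N r)"


section \<open>Formulas, theories, saturation\<close>

datatype 'f tm = Var nat | App 'f "'f tm list"

datatype ('f, 'r) fm =
    Eq "'f tm" "'f tm"
  | Rel 'r "'f tm list"
  | Neg "('f, 'r) fm"
  | Conj "('f, 'r) fm" "('f, 'r) fm"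
  | Exists nat "('f, 'r) fm"

fun wf_tm :: "('f, 'r) lang \<Rightarrow> 'f tm \<Rightarrow> bool" where
  "wf_tm L (Var i) \<longleftrightarrow> True"
| "wf_tm L (App f ts) \<longleftrightarrow> f \<in> funs L \<and> length ts = farity L f \<and> (\<forall>t \<in> set ts. wf_tm L t)"

fun wf_fm :: "('f, 'r) lang \<Rightarrow> ('f, 'r) fm \<Rightarrow> bool" where
  "wf_fm L (Eq s t) \<longleftrightarrow> wf_tm L s \<and> wf_tm L t"
| "wf_fm L (Rel r ts) \<longleftrightarrow> r \<in> rels L \<and> length ts = rarity L r \<and> (\<forall>t \<in> set ts. wf_tm L t)"
| "wf_fm L (Neg \<phi>) \<longleftrightarrow> wf_fm L \<phi>"
| "wf_fm L (Conj \<phi> \<psi>) \<longleftrightarrow> wf_fm L \<phi> \<and> wf_fm L \<psi>"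
| "wf_fm L (Exists i \<phi>) \<longleftrightarrow> wf_fm L \<phi>"

fun fv_tm :: "'f tm \<Rightarrow> nat set" where
  "fv_tm (Var i) = {i}"
| "fv_tm (App f ts) = (\<Union>t \<in> set ts. fv_tm t)"

fun fv :: "('f, 'r) fm \<Rightarrow> nat set" where
  "fv (Eq s t) = fv_tm s \<union> fv_tm t"
| "fv (Rel r ts) = (\<Union>t \<in> set ts. fv_tm t)"
| "fv (Neg \<phi>) = fv \<phi>"
| "fv (Conj \<phi> \<psi>) = fv \<phi> \<union> fv \<psi>"
| "fv (Exists i \<phi>) = fv \<phi> - {i}"

fun is_atomic :: "('f, 'r) fm \<Rightarrow> bool" where
  "is_atomic (Eq s t) \<longleftrightarrow> True"
| "is_atomic (Rel r ts) \<longleftrightarrow> True"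
| "is_atomic _ \<longleftrightarrow> False"

fun tm_val :: "('f, 'r, 'u) struct \<Rightarrow> (nat \<Rightarrow> 'u) \<Rightarrow> 'f tm \<Rightarrow> 'u" where
  "tm_val M e (Var i) = e i"
| "tm_val M e (App f ts) = fint M f (map (tm_val M e) ts)"

fun sat :: "('f, 'r, 'u) struct \<Rightarrow> (nat \<Rightarrow> 'u) \<Rightarrow> ('f, 'r) fm \<Rightarrow> bool" where
  "sat M e (Eq s t) \<longleftrightarrow> tm_val M e s = tm_val M e t"
| "sat M e (Rel r ts) \<longleftrightarrow> map (tm_val M e) ts \<in> rint M r"
| "sat M e (Neg \<phi>) \<longleftrightarrow> \<not> sat M e \<phi>"
| "sat M e (Conj \<phi> \<psi>) \<longleftrightarrow> sat M e \<phi> \<and> sat M e \<psi>"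
| "sat M e (Exists i \<phi>) \<longleftrightarrow> (\<exists>c \<in> carrier M. sat M (e(i := c)) \<phi>)"

text \<open>
  A tuple \<open>a\<close> is assigned to the variables \<open>0, \<dots>, length a - 1\<close>. This is only used for formulas
  whose free variables are among these, so that the values of \<open>(!) a\<close> at larger indices are
  irrelevant.
\<close>

definition formulas :: "('f, 'r) lang \<Rightarrow> nat \<Rightarrow> ('f, 'r) fm set" where
  "formulas L n = {\<phi>. wf_fm L \<phi> \<and> fv \<phi> \<subseteq> {..<n}}"

definition sat_tuple :: "('f, 'r, 'u) struct \<Rightarrow> 'u list \<Rightarrow> ('f, 'r) fm \<Rightarrow> bool" where
  "sat_tuple M a \<phi> \<longleftrightarrow> sat M ((!) a) \<phi>"

definition is_theory :: "('f, 'r) lang \<Rightarrow> ('f, 'r) fm set \<Rightarrow> bool" where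
  "is_theory L T \<longleftrightarrow> T \<subseteq> formulas L 0"

definition models :: "('f, 'r) lang \<Rightarrow> ('f, 'r) fm set \<Rightarrow> ('f, 'r, 'u) struct set" where
  "models L T = {M. is_struct L M \<and> (\<forall>\<phi> \<in> T. sat_tuple M [] \<phi>)}"

text \<open>
  A 1-type over a finite set \<open>A\<close> of parameters, enumerated by the tuple \<open>a\<close>, is a set of formulas
  in which the variables below \<open>length a\<close> stand for the parameters and the variable
  \<open>length a\<close> is the variable of the type. Consistency with the theory of \<open>M\<close> with parameters
  from \<open>A\<close> amounts to finite satisfiability in \<open>M\<close>.
\<close>

definition aleph0_saturated :: "('f, 'r) lang \<Rightarrow> ('f, 'r, 'u) struct \<Rightarrow> bool" where
  "aleph0_saturated L M \<longleftrightarrow>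
     (\<forall>a p. set a \<subseteq> carrier M \<and> p \<subseteq> formulas L (Suc (length a)) \<and>
            (\<forall>q. finite q \<and> q \<subseteq> p \<longrightarrow>
                 (\<exists>c \<in> carrier M. \<forall>\<phi> \<in> q. sat_tuple M (a @ [c]) \<phi>)) \<longrightarrow>
            (\<exists>c \<in> carrier M. \<forall>\<phi> \<in> p. sat_tuple M (a @ [c]) \<phi>))"

text \<open>The first argument fixes the universe in which models are taken.\<close>

definition rich ::
  "'u itself \<Rightarrow> ('f, 'r) lang \<Rightarrow> ('f, 'r) fm set \<Rightarrow> 'k rel \<Rightarrow> bool" where
  "rich U L T \<kappa> \<longleftrightarrow>
     |funs L <+> rels L| +c natLeq \<le>o \<kappa> \<and>
     (\<exists>M :: ('f, 'r, 'u) struct. M \<in> models L T \<and> infinite (carrier M)) \<and>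
     (\<forall>M :: ('f, 'r, 'u) struct. M \<in> models L T \<and> |carrier M| =o \<kappa> \<longrightarrow> aleph0_saturated L M)"


section \<open>Potentialist systems and bisimulations\<close>

text \<open>The embeddings of a system are recorded together with their source and target.\<close>

record ('f, 'r, 'u) psystem =
  worlds :: "('f, 'r, 'u) struct set"
  maps :: "(('f, 'r, 'u) struct \<times> ('u \<Rightarrow> 'u) \<times> ('f, 'r, 'u) struct) set"

definition potentialist_system :: "('f, 'r) lang \<Rightarrow> ('f, 'r, 'u) psystem \<Rightarrow> bool" where
  "potentialist_system L S \<longleftrightarrow>
     (\<forall>M \<in> worlds S. is_struct L M) \<and>
     (\<forall>M \<pi> N. (M, \<pi>, N) \<in> maps S \<longrightarrow> M \<in> worlds S \<and> N \<in> worlds S \<and> embedding L M \<pi> N) \<and>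
     (\<forall>M \<in> worlds S. (M, restrict (\<lambda>x. x) (carrier M), M) \<in> maps S) \<and>
     (\<forall>M \<pi> N \<rho> P. (M, \<pi>, N) \<in> maps S \<and> (N, \<rho>, P) \<in> maps S \<longrightarrow>
        (M, compose (carrier M) \<rho> \<pi>, P) \<in> maps S)"

definition set_sized :: "('f, 'r, 'u) psystem \<Rightarrow> bool" where
  "set_sized S \<longleftrightarrow> |worlds S| <o |UNIV :: 'u set|"

definition Mod :: "('f, 'r) lang \<Rightarrow> ('f, 'r) fm set \<Rightarrow> ('f, 'r, 'u) psystem" where
  "Mod L T =
     \<lparr>worlds = models L T,
      maps = {(M, restrict (\<lambda>x. x) (carrier M), N) | M N.
                M \<in> models L T \<and> N \<in> models L T \<and> substructure L M N}\<rparr>"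

definition Mod_below ::
  "'k rel \<Rightarrow> ('f, 'r) lang \<Rightarrow> ('f, 'r) fm set \<Rightarrow> ('f, 'r, 'u) psystem" where
  "Mod_below \<mu> L T =
     (let W = {M \<in> worlds (Mod L T). |carrier M| <o \<mu>}
      in \<lparr>worlds = W, maps = {(M, \<pi>, N) \<in> maps (Mod L T). M \<in> W \<and> N \<in> W}\<rparr>)"

definition pointed :: "('f, 'r, 'u) psystem \<Rightarrow> ('f, 'r, 'u) struct \<Rightarrow> 'u list \<Rightarrow> bool" where
  "pointed S M a \<longleftrightarrow> M \<in> worlds S \<and> set a \<subseteq> carrier M"

definition bisimulation ::
  "('f, 'r) lang \<Rightarrow> ('f, 'r, 'u) psystem \<Rightarrow> ('f, 'r, 'v) psystem \<Rightarrow>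
   (('f, 'r, 'u) struct \<Rightarrow> 'u list \<Rightarrow> ('f, 'r, 'v) struct \<Rightarrow> 'v list \<Rightarrow> bool) \<Rightarrow> bool" where
  "bisimulation L S S' R \<longleftrightarrow>
     (\<exists>M a N b. R M a N b) \<and>
     (\<forall>M a N b. R M a N b \<longrightarrow>
        pointed S M a \<and> pointed S' N b \<and> length a = length b \<and>
        (\<forall>\<phi> \<in> formulas L (length a). is_atomic \<phi> \<longrightarrow> (sat_tuple M a \<phi> \<longleftrightarrow> sat_tuple N b \<phi>)) \<and>
        (\<forall>c \<in> carrier M. \<exists>d \<in> carrier N. R M (a @ [c]) N (b @ [d])) \<and>
        (\<forall>d \<in> carrier N. \<exists>c \<in> carrier M. R M (a @ [c]) N (b @ [d])) \<and>
        (\<forall>\<pi> M'. (M, \<pi>, M') \<in> maps S \<longrightarrow>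
           (\<exists>\<rho> N'. (N, \<rho>, N') \<in> maps S' \<and> R M' (map \<pi> a) N' (map \<rho> b))) \<and>
        (\<forall>\<rho> N'. (N, \<rho>, N') \<in> maps S' \<longrightarrow>
           (\<exists>\<pi> M'. (M, \<pi>, M') \<in> maps S \<and> R M' (map \<pi> a) N' (map \<rho> b))))"

definition bitotal ::
  "('f, 'r, 'u) psystem \<Rightarrow> ('f, 'r, 'v) psystem \<Rightarrow>
   (('f, 'r, 'u) struct \<Rightarrow> 'u list \<Rightarrow> ('f, 'r, 'v) struct \<Rightarrow> 'v list \<Rightarrow> bool) \<Rightarrow> bool" where
  "bitotal S S' R \<longleftrightarrow>
     (\<forall>M a. pointed S M a \<longrightarrow> (\<exists>N b. R M a N b)) \<and>
     (\<forall>N b. pointed S' N b \<longrightarrow> (\<exists>M a. R M a N b))"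

definition bitotally_bisimilar ::
  "('f, 'r) lang \<Rightarrow> ('f, 'r, 'u) psystem \<Rightarrow> ('f, 'r, 'v) psystem \<Rightarrow> bool" where
  "bitotally_bisimilar L S S' \<longleftrightarrow>
     potentialist_system L S \<and> potentialist_system L S' \<and>
     (\<exists>R. bisimulation L S S' R \<and> bitotal S S' R)"

end

theory Submission
  imports Defs
begin

text \<open>
  Call a model \<open>\<kappa>\<close>-small if it has at most \<open>\<kappa>\<close> elements. A
  \<open>\<kappa>\<close>-small model is matched with itself. A model \<open>M\<close> with at
  least \<open>\<kappa>\<close> elements, marked with a tuple \<open>a\<close>, is matched with
  every model \<open>N\<close> of size exactly \<open>\<kappa>\<close> that contains a tuple
  \<open>b\<close> of the same complete type. Richness enters through saturation: every model of
  size at least \<open>\<kappa>\<close> is \<open>\<aleph>\<^sub>0\<close>-saturated, since a type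
  over finitely many parameters is already realized in an elementary submodel of size
  \<open>\<kappa>\<close> that contains them (\<open>aleph0_saturated_if_submodels\<close>).
  Saturation on both sides gives the back-and-forth condition for elements.

  For the maps of the systems, if \<open>M\<close> is matched with itself and \<open>M \<subseteq>
  M'\<close>, then \<open>M'\<close> is either \<open>\<kappa>\<close>-small, or has an elementary
  submodel of size \<open>\<kappa>\<close> that includes \<open>M\<close>. If \<open>(M,
  a)\<close> and \<open>(N, b)\<close> have the same type and \<open>M \<subseteq> M'\<close>,
  then some \<open>N' \<supseteq> N\<close> of the same size as \<open>N\<close> satisfies
  \<open>tp(N', b) = tp(M', a)\<close>; this is \<open>extend_to_same_type\<close>. Indeed, a
  finite part of the quantifier-free diagram of \<open>N\<close> over \<open>b\<close> is an
  existential fact about \<open>b\<close>, hence true of \<open>a\<close> in \<open>M\<close>,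
  hence realized in \<open>M'\<close> over \<open>a\<close>. So the diagram of \<open>N\<close> is
  consistent with the type of \<open>a\<close> in \<open>M'\<close>. In place of the compactness
  theorem, the proof uses one ultrapower of \<open>M'\<close>, indexed by maps \<open>h\<close>,
  thought of as maps from \<open>N\<close> to \<open>M'\<close>: the sets of maps that respect one
  given atomic fact and send \<open>b\<close> to \<open>a\<close> have the finite intersection
  property, and modulo an ultrafilter that contains them \<open>c \<mapsto> (h \<mapsto> h
  c)\<close> embeds \<open>N\<close>. The downward Loewenheim-Skolem theorem cuts the ultrapower
  down to the size of \<open>N\<close>, and a renaming of elements moves it back into the
  universe, over \<open>N\<close>. The situation is symmetric in \<open>M\<close> and
  \<open>N\<close>, so a map out of either model is matched by one out of the other.

  The \<open>\<kappa>\<close>-small models do not form a set-sized system, as a model has copies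
  all over the universe. But they are bisimilar, through isomorphisms, with the models whose
  domain lies in one fixed set \<open>A\<close> of size \<open>\<kappa>\<close>, provided that all
  embeddings are admitted as maps, because \<open>A\<close> has no room for inclusions. There are
  at most \<open>2\<^sup>\<kappa>\<close> such models. Bitotal bisimilarity is transitive, which
  gives the second claim.
\<close>

section \<open>Closures of small sets under finitary operations\<close>

text \<open>
  Terms, formulas and Skolem hulls are all closures of this kind, so that one cardinality bound
  serves for all of them.
\<close>

inductive_set op_hull :: "('a list \<Rightarrow> 'a) set \<Rightarrow> 'a set \<Rightarrow> 'a set"
  for F :: "('a list \<Rightarrow> 'a) set" and X :: "'a set" where
  base: "x \<in> X \<Longrightarrow> x \<in> op_hull F X"
| step: "f \<in> F \<Longrightarrow> xs \<in> lists (op_hull F X) \<Longrightarrow> f xs \<in> op_hull F X"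

lemma card_image_ordLeq: "|A| \<le>o \<kappa> \<Longrightarrow> |g ` A| \<le>o \<kappa>"
  using card_of_image ordLeq_transitive by blast

lemma countable_ordLeq:
  assumes "Cinfinite \<kappa>"
  shows "|A :: nat set| \<le>o \<kappa>"
proof -
  have "|A| \<le>o |UNIV :: nat set|" by (simp add: card_of_mono1)
  also have "|UNIV :: nat set| \<le>o \<kappa>"
    using natLeq_ordLeq_cinfinite[OF assms] card_of_nat ordIso_ordLeq_trans by blast
  finally show ?thesis .
qed

lemma card_lists_ordLeq:
  assumes "Cinfinite \<kappa>" "|A| \<le>o \<kappa>"
  shows "|lists A| \<le>o \<kappa>"
proof -
  have inf: "infinite (Field \<kappa>)" and card: "Card_order \<kappa>"
    using assms by (auto simp: cinfinite_def)
  define B where "B n = {xs \<in> lists A. length xs = n}" for n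
  have "|B n| \<le>o \<kappa>" for n
  proof (induction n)
    case 0
    have "B 0 = (\<lambda>n. []) ` {0::nat}" by (auto simp: B_def)
    then show ?case using countable_ordLeq[OF assms(1)] card_image_ordLeq by metis
  next
    case (Suc n)
    have "B (Suc n) = (\<lambda>(x, xs). x # xs) ` (A \<times> B n)"
      by (auto simp: B_def image_iff length_Suc_conv Cons_in_lists_iff)
    moreover have "|A \<times> B n| \<le>o \<kappa>"
      using card_of_Times_ordLeq_infinite_Field inf card assms(2) Suc by blast
    ultimately show ?case using card_image_ordLeq by metis
  qed
  moreover have "lists A = (\<Union>n. B n)" by (auto simp: B_def)
  ultimately show ?thesis
    using card_of_UNION_ordLeq_infinite_Field[OF inf card, of "UNIV :: nat set" B]
      countable_ordLeq[OF assms(1)] by simp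
qed

text \<open>
  The closure is the union of countably many stages; a finite list over the union already lies
  over one stage, because the stages increase.
\<close>

lemma card_op_hull_ordLeq:
  assumes "Cinfinite \<kappa>" "|F| \<le>o \<kappa>" "|X| \<le>o \<kappa>"
  shows "|op_hull F X| \<le>o \<kappa>"
proof -
  have inf: "infinite (Field \<kappa>)" and card: "Card_order \<kappa>"
    using assms by (auto simp: cinfinite_def)
  define S where "S = rec_nat X (\<lambda>n A. A \<union> (\<lambda>(f, xs). f xs) ` (F \<times> lists A))"
  have S0: "S 0 = X" and SSuc: "\<And>n. S (Suc n) = S n \<union> (\<lambda>(f, xs). f xs) ` (F \<times> lists (S n))"
    by (simp_all add: S_def)
  have S_mono: "S m \<subseteq> S n" if "m \<le> n" for m n
    using lift_Suc_mono_le[of S, OF _ that] SSuc by blast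
  have lists_S: "\<exists>n. xs \<in> lists (S n)" if "xs \<in> lists (\<Union>n. S n)" for xs
    using that
  proof (induction xs)
    case (Cons x xs)
    then obtain m n where "x \<in> S m" "xs \<in> lists (S n)" by auto
    then have "x # xs \<in> lists (S (max m n))"
      using S_mono[of m "max m n"] S_mono[of n "max m n"] by auto
    then show ?case by blast
  qed auto
  have "x \<in> (\<Union>n. S n)" if "x \<in> op_hull F X" for x
    using that
  proof (induction rule: op_hull.induct)
    case (base x)
    then show ?case using S0 by blast
  next
    case (step f xs)
    then have "xs \<in> lists (\<Union>n. S n)" by auto
    then obtain n where "xs \<in> lists (S n)" using lists_S by blast
    then have "f xs \<in> S (Suc n)" using step(1) SSuc by force
    then show ?case by blast
  qed
  moreover have "|S n| \<le>o \<kappa>" for n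
  proof (induction n)
    case (Suc n)
    have "|F \<times> lists (S n)| \<le>o \<kappa>"
      using card_of_Times_ordLeq_infinite_Field[OF inf assms(2) card_lists_ordLeq[OF assms(1) Suc]] card
      by blast
    then show ?case unfolding SSuc
      using card_of_Un_ordLeq_infinite_Field[OF inf Suc] card_image_ordLeq card by blast
  qed (simp add: S0 assms)
  then have "|\<Union>n. S n| \<le>o \<kappa>"
    using card_of_UNION_ordLeq_infinite_Field[OF inf card, of "UNIV :: nat set" S]
      countable_ordLeq[OF assms(1)] by simp
  ultimately show ?thesis
    using card_of_mono1[of "op_hull F X" "\<Union>n. S n"] ordLeq_transitive by blast
qed

text \<open>
  Only the symbols of the language count, not the types \<open>'f\<close> and \<open>'r\<close>:
  the well-formed formulas lie in the closure of the atomic ones under the connectives.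
\<close>

lemma card_wf_fm_ordLeq:
  fixes L :: "('f, 'r) lang"
  assumes "Cinfinite \<kappa>" "|funs L| \<le>o \<kappa>" "|rels L| \<le>o \<kappa>"
  shows "|{\<phi>. wf_fm L \<phi>}| \<le>o \<kappa>"
proof -
  have inf: "infinite (Field \<kappa>)" and card: "Card_order \<kappa>"
    using assms by (auto simp: cinfinite_def)
  note times = card_of_Times_ordLeq_infinite_Field[OF inf _ _ card]
    and un = card_of_Un_ordLeq_infinite_Field[OF inf _ _ card]
  let ?tms = "op_hull (App ` funs L) (range Var)"
  have tms: "|?tms| \<le>o \<kappa>"
    by (intro card_op_hull_ordLeq card_image_ordLeq assms countable_ordLeq)
  have wf_tms: "t \<in> ?tms" if "wf_tm L t" for t
    using that
  proof (induction t)
    case (App f ts)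
    then show ?case by (intro op_hull.step) auto
  qed (auto intro: op_hull.base)
  define atoms where
    "atoms = (\<lambda>(s, t). Eq s t) ` (?tms \<times> ?tms) \<union> (\<lambda>(r, ts). Rel r ts) ` (rels L \<times> lists ?tms)"
  define ops where "ops = {\<lambda>xs. Neg (xs ! 0)} \<union> {\<lambda>xs. Conj (xs ! 0) (xs ! 1)}
    \<union> range (\<lambda>i xs. Exists i (xs ! 0 :: ('f, 'r) fm))"
  have atoms: "|atoms| \<le>o \<kappa>"
    unfolding atoms_def
    by (intro un card_image_ordLeq times card_lists_ordLeq tms assms)
  have singl: "|{g}| \<le>o \<kappa>" for g :: "('f, 'r) fm list \<Rightarrow> ('f, 'r) fm"
    using card_image_ordLeq[OF countable_ordLeq[OF assms(1), of "{0}"], of "\<lambda>_. g"] by simp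
  have ops: "|ops| \<le>o \<kappa>"
    unfolding ops_def
    by (intro un singl card_image_ordLeq countable_ordLeq[OF assms(1)])
  have "\<phi> \<in> op_hull ops atoms" if "wf_fm L \<phi>" for \<phi>
    using that
  proof (induction \<phi>)
    case (Eq s t)
    then show ?case by (auto intro!: op_hull.base wf_tms simp: atoms_def)
  next
    case (Rel r ts)
    then show ?case by (auto intro!: op_hull.base wf_tms simp: atoms_def image_iff)
  next
    case (Neg \<phi>)
    then show ?case using op_hull.step[of "\<lambda>xs. Neg (xs ! 0)" ops "[\<phi>]"] by (simp add: ops_def)
  next
    case (Conj \<phi> \<psi>)
    then show ?case
      using op_hull.step[of "\<lambda>xs. Conj (xs ! 0) (xs ! 1)" ops "[\<phi>, \<psi>]"] by (simp add: ops_def)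
  next
    case (Exists i \<phi>)
    then show ?case
      using op_hull.step[of "\<lambda>xs. Exists i (xs ! 0)" ops "[\<phi>]"] by (simp add: ops_def)
  qed
  then have "|{\<phi>. wf_fm L \<phi>}| \<le>o |op_hull ops atoms|" by (intro card_of_mono1) auto
  then show ?thesis using card_op_hull_ordLeq[OF assms(1) ops atoms] ordLeq_transitive by blast
qed

section \<open>Elementary substructures\<close>

lemma tm_val_cong: "(\<And>i. i \<in> fv_tm t \<Longrightarrow> e i = e' i) \<Longrightarrow> tm_val M e t = tm_val M e' t"
proof (induction t)
  case (App f ts)
  have "map (tm_val M e) ts = map (tm_val M e') ts"
    by (rule map_cong[OF refl]) (rule App.IH, use App.prems in auto)
  then show ?case by (simp only: tm_val.simps)
qed simp

lemma sat_cong: "(\<And>i. i \<in> fv \<phi> \<Longrightarrow> e i = e' i) \<Longrightarrow> sat M e \<phi> \<longleftrightarrow> sat M e' \<phi>"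
proof (induction \<phi> arbitrary: e e')
  case (Eq s t)
  then show ?case using tm_val_cong[of s e e' M] tm_val_cong[of t e e' M] by auto
next
  case (Rel r ts)
  then have "map (tm_val M e) ts = map (tm_val M e') ts"
    by (auto intro!: tm_val_cong)
  then show ?case by (simp only: sat.simps)
next
  case (Neg \<phi>)
  have "sat M e \<phi> \<longleftrightarrow> sat M e' \<phi>"
    by (rule Neg.IH) (use Neg.prems in auto)
  then show ?case by simp
next
  case (Conj \<phi> \<psi>)
  have "sat M e \<phi> \<longleftrightarrow> sat M e' \<phi>" "sat M e \<psi> \<longleftrightarrow> sat M e' \<psi>"
    by (rule Conj.IH; use Conj.prems in auto)+
  then show ?case by simp
next
  case (Exists i \<phi>)
  have "sat M (e(i := c)) \<phi> \<longleftrightarrow> sat M (e'(i := c)) \<phi>" for c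
    by (rule Exists.IH) (use Exists.prems in auto)
  then show ?case by simp
qed

lemma finite_fv_tm: "finite (fv_tm t)"
  by (induction t) auto

lemma finite_fv: "finite (fv \<phi>)"
  by (induction \<phi>) (auto simp: finite_fv_tm)

text \<open>
  Unlike \<open>is_struct\<close>, this imposes neither a bound on the size nor default values,
  and so it applies to ultrapowers, whose elements are functions and whose domain may be as large
  as their type.
\<close>

definition closed_struct :: "('f, 'r) lang \<Rightarrow> ('f, 'r, 'a) struct \<Rightarrow> bool" where
  "closed_struct L M \<longleftrightarrow> carrier M \<noteq> {} \<and>
     (\<forall>f \<in> funs L. \<forall>xs \<in> tuples (carrier M) (farity L f). fint M f xs \<in> carrier M)"

definition elementary :: "('f, 'r) lang \<Rightarrow> ('f, 'r, 'a) struct \<Rightarrow> ('f, 'r, 'a) struct \<Rightarrow> bool" where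
  "elementary L M N \<longleftrightarrow> carrier M \<subseteq> carrier N \<and>
     (\<forall>\<phi> e. wf_fm L \<phi> \<and> range e \<subseteq> carrier M \<longrightarrow> sat M e \<phi> = sat N e \<phi>)"

definition restr_struct :: "('f, 'r) lang \<Rightarrow> ('f, 'r, 'a) struct \<Rightarrow> 'a set \<Rightarrow> ('f, 'r, 'a) struct" where
  "restr_struct L M H = \<lparr>carrier = H,
     fint = (\<lambda>f xs. if f \<in> funs L \<and> xs \<in> tuples H (farity L f) then fint M f xs else undefined),
     rint = (\<lambda>r. if r \<in> rels L then rint M r \<inter> tuples H (rarity L r) else {})\<rparr>"

lemma carrier_restr_struct [simp]: "carrier (restr_struct L M H) = H"
  by (simp add: restr_struct_def)

lemma is_struct_closed: "is_struct L M \<Longrightarrow> closed_struct L M"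
  unfolding is_struct_def closed_struct_def by metis

lemma tm_val_closed:
  assumes "closed_struct L M" "range e \<subseteq> carrier M"
  shows "wf_tm L t \<Longrightarrow> tm_val M e t \<in> carrier M"
proof (induction t)
  case (Var i)
  then show ?case using assms by auto
next
  case (App f ts)
  then have "map (tm_val M e) ts \<in> tuples (carrier M) (farity L f)" by (auto simp: tuples_def)
  then show ?case using App assms by (auto simp: closed_struct_def)
qed

lemma tm_val_restr_struct:
  assumes "closed_struct L (restr_struct L M H)" "range e \<subseteq> H"
  shows "wf_tm L t \<Longrightarrow> tm_val (restr_struct L M H) e t = tm_val M e t"
proof (induction t)
  case (App f ts)
  have "tm_val (restr_struct L M H) e t \<in> H" if "t \<in> set ts" for t
    using tm_val_closed[OF assms(1), of e t] assms(2) App.prems that by simp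
  then have "map (tm_val (restr_struct L M H) e) ts \<in> tuples H (farity L f)"
    using App.prems by (auto simp: tuples_def simp del: App.IH)
  moreover have "map (tm_val (restr_struct L M H) e) ts = map (tm_val M e) ts"
    using App by auto
  ultimately have "map (tm_val M e) ts \<in> tuples H (farity L f)" by simp
  then show ?case using App.prems \<open>map _ ts = map _ ts\<close>
    by (simp add: restr_struct_def del: map_eq_conv)
qed simp

text \<open>
  In the induction only an existential quantifier can tell the substructure from \<open>M\<close>,
  and there the witness assumption supplies an element of \<open>H\<close>.
\<close>

lemma Tarski_Vaught:
  assumes "H \<subseteq> carrier M" "closed_struct L (restr_struct L M H)"
    and witness: "\<And>\<phi> i e. wf_fm L \<phi> \<Longrightarrow> range e \<subseteq> H \<Longrightarrow> \<exists>c \<in> carrier M. sat M (e(i := c)) \<phi> \<Longrightarrow>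
      \<exists>c \<in> H. sat M (e(i := c)) \<phi>"
  shows "elementary L (restr_struct L M H) M"
proof -
  have "sat (restr_struct L M H) e \<phi> = sat M e \<phi>" if "wf_fm L \<phi>" "range e \<subseteq> H" for \<phi> e
    using that
  proof (induction \<phi> arbitrary: e)
    case (Eq s t)
    then show ?case using tm_val_restr_struct[OF assms(2)] by simp
  next
    case (Rel r ts)
    then have "map (tm_val (restr_struct L M H) e) ts = map (tm_val M e) ts"
      using tm_val_restr_struct[OF assms(2)] by auto
    moreover have "map (tm_val (restr_struct L M H) e) ts \<in> tuples H (rarity L r)"
      using Rel tm_val_closed[OF assms(2)] by (auto simp: tuples_def)
    ultimately show ?case using Rel by (simp add: restr_struct_def del: map_eq_conv)
  next
    case (Exists i \<phi>)
    have "sat (restr_struct L M H) (e(i := c)) \<phi> = sat M (e(i := c)) \<phi>" if "c \<in> H" for c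
      by (rule Exists.IH) (use Exists.prems that in auto)
    moreover have "(\<exists>c \<in> carrier M. sat M (e(i := c)) \<phi>) = (\<exists>c \<in> H. sat M (e(i := c)) \<phi>)"
      using witness[of \<phi> e i] Exists.prems assms(1) by auto
    ultimately show ?case by simp
  qed auto
  then show ?thesis using assms(1) by (simp add: elementary_def)
qed

text \<open>
  \<open>H\<close> is the hull of \<open>X\<close> under the functions of \<open>M\<close> and
  under a witness function for each pair of a formula and a variable. A formula has finitely many
  free variables, so its witness function can take a finite list as argument.
\<close>

lemma downward_Loewenheim_Skolem:
  assumes M: "closed_struct L M" and \<kappa>: "Cinfinite \<kappa>"
    and L: "|funs L| \<le>o \<kappa>" "|rels L| \<le>o \<kappa>"
    and X: "X \<subseteq> carrier M" "|X| \<le>o \<kappa>"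
  obtains H where "X \<subseteq> H" "H \<subseteq> carrier M" "|H| \<le>o \<kappa>"
    "closed_struct L (restr_struct L M H)" "elementary L (restr_struct L M H) M"
proof -
  have inf: "infinite (Field \<kappa>)" and card: "Card_order \<kappa>"
    using \<kappa> by (auto simp: cinfinite_def)
  obtain m where m: "m \<in> carrier M" using M by (auto simp: closed_struct_def)
  \<comment> \<open>The value \<open>m\<close> pads short lists and makes all operations total with values
    in \<open>M\<close>.\<close>
  define env where "env xs k = (if k < length xs then xs ! k else m)" for xs k
  define wit where "wit = (\<lambda>(\<phi>, i) xs. if \<exists>c \<in> carrier M. sat M ((env xs)(i := c)) \<phi>
     then SOME c. c \<in> carrier M \<and> sat M ((env xs)(i := c)) \<phi> else m)"
  define ap where "ap f xs = (if xs \<in> tuples (carrier M) (farity L f) then fint M f xs else m)" for f xs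
  define F where "F = wit ` ({\<phi>. wf_fm L \<phi>} \<times> UNIV) \<union> ap ` funs L"
  define H where "H = op_hull F (insert m X)"
  have wit: "wit (\<phi>, i) xs \<in> carrier M \<and> sat M ((env xs)(i := wit (\<phi>, i) xs)) \<phi>"
    if "\<exists>c \<in> carrier M. sat M ((env xs)(i := c)) \<phi>" for \<phi> i xs
    using that someI_ex[of "\<lambda>c. c \<in> carrier M \<and> sat M ((env xs)(i := c)) \<phi>"]
    by (auto simp: wit_def)
  have wit_in: "wit (\<phi>, i) xs \<in> carrier M" for \<phi> i xs
    using wit[of xs i \<phi>] m by (cases "\<exists>c \<in> carrier M. sat M ((env xs)(i := c)) \<phi>") (auto simp: wit_def)
  have "|F| \<le>o \<kappa>"
    unfolding F_def
    by (intro card_of_Un_ordLeq_infinite_Field[OF inf _ _ card] card_image_ordLeq L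
        card_of_Times_ordLeq_infinite_Field[OF inf _ _ card] card_wf_fm_ordLeq[OF \<kappa>]
        countable_ordLeq[OF \<kappa>])
  moreover have "|insert m X| \<le>o \<kappa>"
    using card_of_Un_ordLeq_infinite_Field[OF inf _ X(2) card, of "{m}"]
      card_image_ordLeq[OF countable_ordLeq[OF \<kappa>, of "{0}"], of "\<lambda>_. m"] by simp
  ultimately have H_card: "|H| \<le>o \<kappa>"
    unfolding H_def by (intro card_op_hull_ordLeq \<kappa>)
  have "x \<in> carrier M" if "x \<in> H" for x
    using that unfolding H_def
  proof (induction rule: op_hull.induct)
    case (base x)
    then show ?case using X m by auto
  next
    case (step f xs)
    then show ?case using wit_in m M by (auto simp: F_def ap_def closed_struct_def split: if_splits)
  qed
  then have H_sub: "H \<subseteq> carrier M" by auto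
  have H_closed: "closed_struct L (restr_struct L M H)"
    unfolding closed_struct_def
  proof (intro conjI ballI)
    show "carrier (restr_struct L M H) \<noteq> {}" by (auto simp: H_def intro: op_hull.base)
  next
    fix f xs assume f: "f \<in> funs L" and xs: "xs \<in> tuples (carrier (restr_struct L M H)) (farity L f)"
    then have "fint (restr_struct L M H) f xs = ap f xs"
      using H_sub by (auto simp: restr_struct_def ap_def tuples_def)
    moreover have "ap f xs \<in> H"
      unfolding H_def by (rule op_hull.step) (use f xs in \<open>auto simp: F_def H_def tuples_def\<close>)
    ultimately show "fint (restr_struct L M H) f xs \<in> carrier (restr_struct L M H)" by simp
  qed
  have "elementary L (restr_struct L M H) M"
  proof (rule Tarski_Vaught[OF H_sub H_closed])
    fix \<phi> i and e :: "nat \<Rightarrow> 'c"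
    assume wf: "wf_fm L \<phi>" and e: "range e \<subseteq> H" and ex: "\<exists>c \<in> carrier M. sat M (e(i := c)) \<phi>"
    obtain n where n: "\<forall>k \<in> fv \<phi>. k < n" using finite_fv finite_nat_set_iff_bounded by blast
    define xs where "xs = map e [0..<n]"
    have sat: "sat M ((env xs)(i := c)) \<phi> = sat M (e(i := c)) \<phi>" for c
      by (rule sat_cong) (use n in \<open>auto simp: env_def xs_def\<close>)
    have "wit (\<phi>, i) \<in> F" "xs \<in> lists H"
      using wf e by (force simp: F_def xs_def)+
    then have "wit (\<phi>, i) xs \<in> H" unfolding H_def by (intro op_hull.step)
    then show "\<exists>c \<in> H. sat M (e(i := c)) \<phi>" using wit[of xs i \<phi>] ex sat by auto
  qed
  moreover have "X \<subseteq> H" by (auto simp: H_def intro: op_hull.base)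
  ultimately show thesis using that H_sub H_card H_closed by blast
qed

section \<open>Ultrapowers\<close>

text \<open>
  Ultrafilters are represented as filters so that the calculus of \<open>eventually\<close> is
  available.
\<close>

definition ultra :: "'i filter \<Rightarrow> bool" where
  "ultra F \<longleftrightarrow> F \<noteq> bot \<and> (\<forall>P. eventually P F \<or> eventually (\<lambda>i. \<not> P i) F)"

text \<open>
  Zorn's lemma yields a minimal proper filter below \<open>F\<close>; the infimum of a chain is
  proper because a property holds eventually for it iff it does for a member of the chain. A
  minimal filter decides every property, as it does not change when a property that it does not
  refute is added.
\<close>

lemma ultra_exists:
  assumes "F \<noteq> bot"
  obtains U where "U \<le> F" "ultra U"
proof -
  define A where "A = {G. G \<noteq> bot \<and> G \<le> F}"
  have "\<exists>U \<in> A. \<forall>G \<in> A. G \<le> U \<longrightarrow> G = U"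
  proof (rule predicate_Zorn)
    show "partial_order_on A (relation_of (\<lambda>F G. G \<le> F) A)"
      by (auto simp: partial_order_on_def preorder_on_def relation_of_def refl_on_def
          trans_def antisym_def)
  next
    fix C assume C: "C \<in> Chains (relation_of (\<lambda>F G. G \<le> F) A)"
    show "\<exists>U \<in> A. \<forall>G \<in> C. U \<le> G"
    proof (cases "C = {}")
      case True
      then show ?thesis using assms by (auto simp: A_def)
    next
      case False
      have CA: "C \<subseteq> A" using C by (auto simp: Chains_def relation_of_def)
      have "\<exists>H \<in> C. H \<le> inf G G'" if "G \<in> C" "G' \<in> C" for G G'
        using C that by (auto simp: Chains_def relation_of_def)
      then have "eventually P (Inf C) \<longleftrightarrow> (\<exists>G \<in> C. eventually P G)" for P
        using False by (intro eventually_Inf_base) auto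
      then have "Inf C \<noteq> bot"
        using CA by (auto simp: A_def trivial_limit_def)
      moreover have "Inf C \<le> F"
        using False CA by (auto simp: A_def intro: Inf_lower2)
      ultimately show ?thesis by (auto simp: A_def intro: Inf_lower)
    qed
  qed
  then obtain U where U: "U \<noteq> bot" "U \<le> F" and max: "\<And>G. G \<noteq> bot \<Longrightarrow> G \<le> U \<Longrightarrow> G = U"
    by (auto simp: A_def intro: order_trans)
  have "eventually P U \<or> eventually (\<lambda>i. \<not> P i) U" for P
  proof (rule disjCI)
    assume "\<not> eventually (\<lambda>i. \<not> P i) U"
    then have "inf U (principal {i. P i}) \<noteq> bot"
      unfolding trivial_limit_def eventually_inf_principal by simp
    then have "inf U (principal {i. P i}) = U" by (intro max inf_le1)
    moreover have "eventually P (inf U (principal {i. P i}))"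
      by (simp add: eventually_inf_principal)
    ultimately show "eventually P U" by (simp only:)
  qed
  with U show thesis by (intro that) (auto simp: ultra_def)
qed

lemma ultra_not: "ultra F \<Longrightarrow> eventually (\<lambda>i. \<not> P i) F \<longleftrightarrow> \<not> eventually P F"
  unfolding ultra_def using eventually_conj[of P F "\<lambda>i. \<not> P i"] by (auto simp: trivial_limit_def)

lemma eventually_cong_eventually:
  assumes "eventually (\<lambda>i. P i = Q i) F"
  shows "eventually P F \<longleftrightarrow> eventually Q F"
proof
  assume "eventually P F"
  with assms show "eventually Q F" by eventually_elim auto
next
  assume "eventually Q F"
  with assms show "eventually P F" by eventually_elim auto
qed

text \<open>
  The chosen representative of the class of \<open>f\<close> modulo \<open>F\<close>. The
  ultrapower consists of representatives, so that its elements are functions that can be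
  evaluated, not classes.
\<close>

definition up_rep :: "'a set \<Rightarrow> 'i filter \<Rightarrow> ('i \<Rightarrow> 'a) \<Rightarrow> ('i \<Rightarrow> 'a)" where
  "up_rep A F f = (SOME g. range g \<subseteq> A \<and> (\<forall>\<^sub>F i in F. f i = g i))"

definition ultrapower ::
  "('f, 'r) lang \<Rightarrow> 'i filter \<Rightarrow> ('f, 'r, 'a) struct \<Rightarrow> ('f, 'r, 'i \<Rightarrow> 'a) struct" where
  "ultrapower L F M = \<lparr>carrier = up_rep (carrier M) F ` {f. range f \<subseteq> carrier M},
     fint = (\<lambda>f xs. up_rep (carrier M) F (\<lambda>i. fint M f (map (\<lambda>x. x i) xs))),
     rint = (\<lambda>r. {xs. \<forall>\<^sub>F i in F. map (\<lambda>x. x i) xs \<in> rint M r})\<rparr>"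

lemma up_rep:
  assumes "range f \<subseteq> A"
  shows "range (up_rep A F f) \<subseteq> A" "\<forall>\<^sub>F i in F. f i = up_rep A F f i"
  using someI[of "\<lambda>g. range g \<subseteq> A \<and> (\<forall>\<^sub>F i in F. f i = g i)" f] assms
  unfolding up_rep_def by auto

text \<open>
  Equivalent functions have the same equivalents, hence the same choice among them.
\<close>

lemma up_rep_eq:
  assumes "\<forall>\<^sub>F i in F. f i = g i"
  shows "up_rep A F f = up_rep A F g"
proof -
  have "(\<forall>\<^sub>F i in F. f i = h i) \<longleftrightarrow> (\<forall>\<^sub>F i in F. g i = h i)" for h
    using assms by (intro eventually_cong_eventually) (auto elim: eventually_mono)
  then show ?thesis by (simp add: up_rep_def)
qed

lemma up_rep_in_carrier: "range f \<subseteq> carrier M \<Longrightarrow> up_rep (carrier M) F f \<in> carrier (ultrapower L F M)"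
  by (auto simp: ultrapower_def)

lemma ultrapower_in_range:
  assumes "x \<in> carrier (ultrapower L F M)"
  shows "x i \<in> carrier M"
proof -
  obtain f where "range f \<subseteq> carrier M" "x = up_rep (carrier M) F f"
    using assms unfolding ultrapower_def struct.simps by blast
  then have "range x \<subseteq> carrier M" using up_rep(1)[of f "carrier M" F] by (simp only:)
  then show ?thesis by blast
qed

lemma ultrapower_eq_iff:
  assumes "x \<in> carrier (ultrapower L F M)" "y \<in> carrier (ultrapower L F M)"
  shows "x = y \<longleftrightarrow> (\<forall>\<^sub>F i in F. x i = y i)"
proof
  assume ev: "\<forall>\<^sub>F i in F. x i = y i"
  have rep: "up_rep (carrier M) F z = z" if z: "z \<in> carrier (ultrapower L F M)" for z
  proof -
    obtain f where f: "range f \<subseteq> carrier M" "z = up_rep (carrier M) F f"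
      using z unfolding ultrapower_def struct.simps by blast
    then have "up_rep (carrier M) F f = up_rep (carrier M) F z"
      using up_rep(2) by (intro up_rep_eq) auto
    with f show ?thesis by simp
  qed
  show "x = y" using up_rep_eq[OF ev] rep[OF assms(1)] rep[OF assms(2)] by metis
qed simp

lemma ultrapower_fint_in_range:
  assumes "closed_struct L M" "f \<in> funs L" "xs \<in> tuples (carrier (ultrapower L F M)) (farity L f)"
  shows "range (\<lambda>i. fint M f (map (\<lambda>x. x i) xs)) \<subseteq> carrier M"
proof -
  have "map (\<lambda>x. x i) xs \<in> tuples (carrier M) (farity L f)" for i
    using assms(3) ultrapower_in_range[of _ L F M i] by (auto simp: tuples_def)
  then show ?thesis using assms by (auto simp: closed_struct_def)
qed

lemma closed_struct_ultrapower:
  assumes "closed_struct L M"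
  shows "closed_struct L (ultrapower L F M)"
  unfolding closed_struct_def
proof (intro conjI ballI)
  obtain m where "m \<in> carrier M" using assms by (auto simp: closed_struct_def)
  then show "carrier (ultrapower L F M) \<noteq> {}"
    using up_rep_in_carrier[of "\<lambda>_. m" M F L] by auto
next
  fix f xs assume "f \<in> funs L" "xs \<in> tuples (carrier (ultrapower L F M)) (farity L f)"
  then have "up_rep (carrier M) F (\<lambda>i. fint M f (map (\<lambda>x. x i) xs)) \<in> carrier (ultrapower L F M)"
    using ultrapower_fint_in_range[OF assms] by (intro up_rep_in_carrier) blast
  then show "fint (ultrapower L F M) f xs \<in> carrier (ultrapower L F M)"
    by (simp add: ultrapower_def)
qed

lemma tm_val_ultrapower:
  assumes M: "closed_struct L M" and e: "range e \<subseteq> carrier (ultrapower L F M)"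
  shows "wf_tm L t \<Longrightarrow> \<forall>\<^sub>F i in F. tm_val (ultrapower L F M) e t i = tm_val M (\<lambda>n. e n i) t"
proof (induction t)
  case (App f ts)
  let ?vs = "map (tm_val (ultrapower L F M) e) ts"
  have vs: "?vs \<in> tuples (carrier (ultrapower L F M)) (farity L f)"
    using App.prems tm_val_closed[OF closed_struct_ultrapower[OF M] e]
    by (auto simp: tuples_def)
  have "\<forall>\<^sub>F i in F. \<forall>t \<in> set ts. tm_val (ultrapower L F M) e t i = tm_val M (\<lambda>n. e n i) t"
    using App by (auto intro: eventually_ball_finite)
  moreover have "\<forall>\<^sub>F i in F. fint M f (map (\<lambda>x. x i) ?vs) =
      up_rep (carrier M) F (\<lambda>i. fint M f (map (\<lambda>x. x i) ?vs)) i"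
    using ultrapower_fint_in_range[OF M _ vs] App.prems by (intro up_rep(2)) auto
  ultimately show ?case
  proof eventually_elim
    case (elim i)
    have "map (\<lambda>x. x i) ?vs = map (tm_val M (\<lambda>n. e n i)) ts" using elim(1) by simp
    then have "tm_val M (\<lambda>n. e n i) (App f ts) = fint M f (map (\<lambda>x. x i) ?vs)"
      by (simp only: tm_val.simps)
    also note elim(2)
    finally show ?case by (simp add: ultrapower_def)
  qed
qed simp

text \<open>
  An existential formula that holds at almost all indices has a witness in the ultrapower,
  obtained by choosing a witness at each of these indices.
\<close>

theorem Los:
  assumes F: "ultra F" and M: "closed_struct L M"
  shows "wf_fm L \<phi> \<Longrightarrow> range e \<subseteq> carrier (ultrapower L F M) \<Longrightarrow>
    sat (ultrapower L F M) e \<phi> \<longleftrightarrow> (\<forall>\<^sub>F i in F. sat M (\<lambda>n. e n i) \<phi>)"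
proof (induction \<phi> arbitrary: e)
  case (Eq s t)
  note closed = tm_val_closed[OF closed_struct_ultrapower[OF M] Eq.prems(2)]
  have "sat (ultrapower L F M) e (Eq s t) \<longleftrightarrow>
      (\<forall>\<^sub>F i in F. tm_val (ultrapower L F M) e s i = tm_val (ultrapower L F M) e t i)"
    using ultrapower_eq_iff[OF closed[of s] closed[of t]] Eq.prems(1) by simp
  also have "\<dots> \<longleftrightarrow> (\<forall>\<^sub>F i in F. tm_val M (\<lambda>n. e n i) s = tm_val M (\<lambda>n. e n i) t)"
  proof (rule eventually_cong_eventually)
    show "\<forall>\<^sub>F i in F. (tm_val (ultrapower L F M) e s i = tm_val (ultrapower L F M) e t i) =
      (tm_val M (\<lambda>n. e n i) s = tm_val M (\<lambda>n. e n i) t)"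
      using eventually_conj[OF tm_val_ultrapower[OF M Eq.prems(2), of s]
          tm_val_ultrapower[OF M Eq.prems(2), of t]] Eq.prems(1)
      by (auto elim: eventually_mono)
  qed
  finally show ?case by simp
next
  case (Rel r ts)
  have ev: "\<forall>\<^sub>F i in F. \<forall>t \<in> set ts. tm_val (ultrapower L F M) e t i = tm_val M (\<lambda>n. e n i) t"
    using Rel tm_val_ultrapower[OF M Rel.prems(2)] by (auto intro: eventually_ball_finite)
  have "sat (ultrapower L F M) e (Rel r ts) \<longleftrightarrow>
    (\<forall>\<^sub>F i in F. map (\<lambda>x. x i) (map (tm_val (ultrapower L F M) e) ts) \<in> rint M r)"
    by (simp add: ultrapower_def)
  also have "\<dots> \<longleftrightarrow> (\<forall>\<^sub>F i in F. map (tm_val M (\<lambda>n. e n i)) ts \<in> rint M r)"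
  proof (rule eventually_cong_eventually)
    show "\<forall>\<^sub>F i in F. (map (\<lambda>x. x i) (map (tm_val (ultrapower L F M) e) ts) \<in> rint M r) =
      (map (tm_val M (\<lambda>n. e n i)) ts \<in> rint M r)"
      using ev
    proof eventually_elim
      case (elim i)
      then have "map (\<lambda>x. x i) (map (tm_val (ultrapower L F M) e) ts) = map (tm_val M (\<lambda>n. e n i)) ts"
        by simp
      then show ?case by (simp only:)
    qed
  qed
  finally show ?case by simp
next
  case (Neg \<phi>)
  then show ?case using ultra_not[OF F] by simp
next
  case (Conj \<phi> \<psi>)
  then show ?case by (simp add: eventually_conj_iff)
next
  case (Exists k \<phi>)
  have upd: "(\<lambda>n. (e(k := c)) n i) = (\<lambda>n. e n i)(k := c i)" for c i by auto
  have IH: "sat (ultrapower L F M) (e(k := c)) \<phi> \<longleftrightarrow> (\<forall>\<^sub>F i in F. sat M ((\<lambda>n. e n i)(k := c i)) \<phi>)"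
    if "c \<in> carrier (ultrapower L F M)" for c
    unfolding upd[symmetric] by (rule Exists.IH) (use Exists.prems that in auto)
  show ?case
  proof
    assume "sat (ultrapower L F M) e (Exists k \<phi>)"
    then obtain c where c: "c \<in> carrier (ultrapower L F M)"
      and "\<forall>\<^sub>F i in F. sat M ((\<lambda>n. e n i)(k := c i)) \<phi>" using IH by auto
    then show "\<forall>\<^sub>F i in F. sat M (\<lambda>n. e n i) (Exists k \<phi>)"
      using ultrapower_in_range[OF c] by (auto elim!: eventually_mono)
  next
    assume ev: "\<forall>\<^sub>F i in F. sat M (\<lambda>n. e n i) (Exists k \<phi>)"
    obtain m where m: "m \<in> carrier M" using M by (auto simp: closed_struct_def)
    define g where "g i = (if sat M (\<lambda>n. e n i) (Exists k \<phi>)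
      then SOME c. c \<in> carrier M \<and> sat M ((\<lambda>n. e n i)(k := c)) \<phi> else m)" for i
    have g: "g i \<in> carrier M \<and> sat M ((\<lambda>n. e n i)(k := g i)) \<phi>"
      if "sat M (\<lambda>n. e n i) (Exists k \<phi>)" for i
      using that someI_ex[of "\<lambda>c. c \<in> carrier M \<and> sat M ((\<lambda>n. e n i)(k := c)) \<phi>"]
      by (auto simp: g_def)
    have "g i \<in> carrier M" for i
      using g[of i] m by (cases "sat M (\<lambda>n. e n i) (Exists k \<phi>)") (auto simp: g_def)
    then have range: "range g \<subseteq> carrier M" by auto
    let ?c = "up_rep (carrier M) F g"
    have "\<forall>\<^sub>F i in F. sat M ((\<lambda>n. e n i)(k := ?c i)) \<phi>"
      using ev up_rep(2)[OF range] by eventually_elim (metis g)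
    then show "sat (ultrapower L F M) e (Exists k \<phi>)"
      using IH[OF up_rep_in_carrier[OF range]] up_rep_in_carrier[OF range, of F L] by auto
  qed
qed

section \<open>Embeddings between structures on different types\<close>

text \<open>
  The ultrapower lives on another type than its base. Thus embeddings are needed that change the
  type, and that ask of the two structures nothing about size or default values.
\<close>

definition is_emb ::
  "('f, 'r) lang \<Rightarrow> ('f, 'r, 'a) struct \<Rightarrow> ('a \<Rightarrow> 'b) \<Rightarrow> ('f, 'r, 'b) struct \<Rightarrow> bool" where
  "is_emb L M h N \<longleftrightarrow> h ` carrier M \<subseteq> carrier N \<and> inj_on h (carrier M) \<and>
     (\<forall>f \<in> funs L. \<forall>xs \<in> tuples (carrier M) (farity L f).
        h (fint M f xs) = fint N f (map h xs)) \<and>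
     (\<forall>r \<in> rels L. \<forall>xs \<in> tuples (carrier M) (rarity L r).
        xs \<in> rint M r \<longleftrightarrow> map h xs \<in> rint N r)"

lemma embedding_iff_is_emb:
  "embedding L M h N \<longleftrightarrow>
     is_struct L M \<and> is_struct L N \<and> h \<in> extensional (carrier M) \<and> is_emb L M h N"
  unfolding embedding_def is_emb_def by (auto simp: PiE_def)

lemma substructure_iff_is_emb:
  "substructure L M N \<longleftrightarrow> is_struct L M \<and> is_struct L N \<and> is_emb L M (\<lambda>x. x) N"
proof -
  have "rint M r = rint N r \<inter> tuples (carrier M) (rarity L r) \<longleftrightarrow>
      (\<forall>xs \<in> tuples (carrier M) (rarity L r). xs \<in> rint M r \<longleftrightarrow> xs \<in> rint N r)"
    if "is_struct L M" "r \<in> rels L" for r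
  proof -
    have "rint M r \<subseteq> tuples (carrier M) (rarity L r)"
      using that unfolding is_struct_def by metis
    then show ?thesis by blast
  qed
  then show ?thesis unfolding substructure_def is_emb_def by (auto simp: inj_on_def)
qed

lemma tm_val_is_emb:
  assumes "is_emb L M h N" "closed_struct L M" "range e \<subseteq> carrier M"
  shows "wf_tm L t \<Longrightarrow> tm_val N (h \<circ> e) t = h (tm_val M e t)"
proof (induction t)
  case (App f ts)
  have "tm_val N (h \<circ> e) t = h (tm_val M e t)" if "t \<in> set ts" for t
    by (rule App.IH) (use App.prems that in auto)
  then have eq: "map (tm_val N (h \<circ> e)) ts = map h (map (tm_val M e) ts)"
    unfolding map_map by (intro map_cong refl) (simp only: comp_apply)
  have "map (tm_val M e) ts \<in> tuples (carrier M) (farity L f)"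
    using App.prems tm_val_closed[OF assms(2,3)] by (auto simp: tuples_def)
  then show ?case
    using assms(1) App.prems unfolding tm_val.simps eq is_emb_def by auto
qed simp

lemma sat_atomic_is_emb:
  assumes "is_emb L M h N" "closed_struct L M" "range e \<subseteq> carrier M" "is_atomic \<phi>" "wf_fm L \<phi>"
  shows "sat N (h \<circ> e) \<phi> \<longleftrightarrow> sat M e \<phi>"
proof (cases \<phi>)
  case (Eq s t)
  then have "tm_val M e s \<in> carrier M" "tm_val M e t \<in> carrier M"
    using assms tm_val_closed by auto
  then show ?thesis
    using Eq assms(1,5) tm_val_is_emb[OF assms(1-3)] by (auto simp: is_emb_def dest: inj_onD)
next
  case (Rel r ts)
  have "tm_val N (h \<circ> e) t = h (tm_val M e t)" if "t \<in> set ts" for t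
    by (rule tm_val_is_emb[OF assms(1-3)]) (use Rel assms(5) that in auto)
  then have eq: "map (tm_val N (h \<circ> e)) ts = map h (map (tm_val M e) ts)"
    unfolding map_map by (intro map_cong refl) (simp only: comp_apply)
  have "map (tm_val M e) ts \<in> tuples (carrier M) (rarity L r)"
    using Rel assms(5) tm_val_closed[OF assms(2,3)] by (auto simp: tuples_def)
  then show ?thesis
    using assms(1,5) Rel unfolding Rel sat.simps eq is_emb_def by auto
qed (use assms in auto)

lemma sat_iso:
  assumes h: "is_emb L M h N" "h ` carrier M = carrier N" and M: "closed_struct L M"
  shows "wf_fm L \<phi> \<Longrightarrow> range e \<subseteq> carrier M \<Longrightarrow> sat N (h \<circ> e) \<phi> \<longleftrightarrow> sat M e \<phi>"
proof (induction \<phi> arbitrary: e)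
  case (Exists i \<phi>)
  have upd: "(h \<circ> e)(i := h c) = h \<circ> (e(i := c))" for c by auto
  have "sat N ((h \<circ> e)(i := h c)) \<phi> \<longleftrightarrow> sat M (e(i := c)) \<phi>" if "c \<in> carrier M" for c
    unfolding upd by (rule Exists.IH) (use Exists.prems that in auto)
  then show ?case unfolding sat.simps h(2)[symmetric] by simp
next
  case (Eq s t)
  then show ?case by (intro sat_atomic_is_emb[OF h(1) M]) auto
next
  case (Rel r ts)
  then show ?case by (intro sat_atomic_is_emb[OF h(1) M]) auto
qed auto

text \<open>
  The converse of \<open>sat_atomic_is_emb\<close>. Injectivity, functions and relations are read
  off from the formulas \<open>x\<^sub>0 = x\<^sub>1\<close>, \<open>f(x\<^sub>0, \<dots>) =
  x\<^sub>n\<close> and \<open>r(x\<^sub>0, \<dots>)\<close>.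
\<close>

lemma is_embI_atomic:
  assumes M: "closed_struct L M" and h: "h ` carrier M \<subseteq> carrier N"
    and sat: "\<And>\<phi> e. is_atomic \<phi> \<Longrightarrow> wf_fm L \<phi> \<Longrightarrow> range e \<subseteq> carrier M \<Longrightarrow>
      sat N (h \<circ> e) \<phi> \<longleftrightarrow> sat M e \<phi>"
  shows "is_emb L M h N"
  unfolding is_emb_def
proof (intro conjI ballI)
  obtain m where m: "m \<in> carrier M" using M by (auto simp: closed_struct_def)
  define env where "env xs k = (if k < length xs then xs ! k else m)" for xs k
  have range: "range (env xs) \<subseteq> carrier M" if "set xs \<subseteq> carrier M" for xs
    using that m by (auto simp: env_def)
  show "h ` carrier M \<subseteq> carrier N" by (fact h)
  show "inj_on h (carrier M)"
  proof (rule inj_onI)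
    fix x y assume xy: "x \<in> carrier M" "y \<in> carrier M" "h x = h y"
    have "sat N (h \<circ> env [x, y]) (Eq (Var 0) (Var 1)) \<longleftrightarrow> sat M (env [x, y]) (Eq (Var 0) (Var 1))"
      by (intro sat range) (use xy in auto)
    with xy have "sat M (env [x, y]) (Eq (Var 0) (Var 1))" by (simp add: env_def)
    then show "x = y" by (simp add: env_def)
  qed
  fix f xs assume f: "f \<in> funs L" and xs: "xs \<in> tuples (carrier M) (farity L f)"
  define n where "n = farity L f"
  define y where "y = fint M f xs"
  have len: "length xs = n" using xs by (auto simp: tuples_def n_def)
  have y: "y \<in> carrier M" using M f xs by (auto simp: closed_struct_def y_def)
  let ?e = "env (xs @ [y])"
  let ?\<phi> = "Eq (App f (map Var [0..<n])) (Var n) :: ('a, 'b) fm"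
  have xs_eq: "map ?e [0..<n] = xs" using len by (auto simp: env_def nth_append intro: nth_equalityI)
  have e_n: "?e n = y" using len by (simp add: env_def nth_append)
  have "sat M ?e ?\<phi>" using xs_eq e_n by (simp add: comp_def y_def)
  moreover have "sat N (h \<circ> ?e) ?\<phi> \<longleftrightarrow> sat M ?e ?\<phi>"
    by (intro sat range) (use f xs y n_def in \<open>auto simp: tuples_def\<close>)
  ultimately have "fint N f (map h (map ?e [0..<n])) = h (?e n)" by (simp add: comp_def)
  then have "fint N f (map h xs) = h y" unfolding xs_eq e_n .
  then show "h (fint M f xs) = fint N f (map h xs)" by (simp add: y_def)
next
  obtain m where m: "m \<in> carrier M" using M by (auto simp: closed_struct_def)
  fix r xs assume r: "r \<in> rels L" and xs: "xs \<in> tuples (carrier M) (rarity L r)"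
  define n where "n = rarity L r"
  have len: "length xs = n" using xs by (auto simp: tuples_def n_def)
  define e where "e k = (if k < length xs then xs ! k else m)" for k
  have xs_eq: "map e [0..<n] = xs" using len by (auto simp: e_def intro: nth_equalityI)
  have "sat N (h \<circ> e) (Rel r (map Var [0..<n])) \<longleftrightarrow> sat M e (Rel r (map Var [0..<n]))"
    by (rule sat) (use r xs m n_def in \<open>auto simp: tuples_def e_def subset_iff\<close>)
  then have "map h (map e [0..<n]) \<in> rint N r \<longleftrightarrow> map e [0..<n] \<in> rint M r"
    by (simp add: comp_def)
  then show "xs \<in> rint M r \<longleftrightarrow> map h xs \<in> rint N r" unfolding xs_eq by blast
qed

lemma is_emb_comp:
  assumes "is_emb L M g N" "is_emb L N h P" "closed_struct L M"
  shows "is_emb L M (h \<circ> g) P"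
proof -
  have "map g xs \<in> tuples (carrier N) n" if "xs \<in> tuples (carrier M) n" for xs n
    using that assms(1) by (auto simp: is_emb_def tuples_def)
  moreover have "inj_on (h \<circ> g) (carrier M)"
    using assms by (auto simp: is_emb_def intro: comp_inj_on inj_on_subset)
  ultimately show ?thesis using assms by (fastforce simp: is_emb_def)
qed

lemma is_emb_cong:
  assumes "is_emb L M g N" "closed_struct L M" "\<And>x. x \<in> carrier M \<Longrightarrow> g x = h x"
  shows "is_emb L M h N"
proof (rule is_embI_atomic[OF assms(2)])
  show "h ` carrier M \<subseteq> carrier N"
    using assms(1,3) unfolding is_emb_def by (metis image_cong)
next
  fix \<phi> :: "('a, 'b) fm" and e :: "nat \<Rightarrow> 'c"
  assume \<phi>: "is_atomic \<phi>" "wf_fm L \<phi>" "range e \<subseteq> carrier M"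
  then have "h \<circ> e = g \<circ> e" using assms(3) by (simp add: fun_eq_iff image_subset_iff)
  then show "sat N (h \<circ> e) \<phi> \<longleftrightarrow> sat M e \<phi>"
    using sat_atomic_is_emb[OF assms(1,2) \<phi>(3,1,2)] by (simp only:)
qed

lemma is_emb_inv:
  assumes g: "is_emb L M g N" "g ` carrier M = carrier N" and M: "closed_struct L M"
  shows "is_emb L N (inv_into (carrier M) g) M"
proof -
  let ?k = "inv_into (carrier M) g"
  have inj: "inj_on g (carrier M)" using g by (simp add: is_emb_def)
  have k: "?k y \<in> carrier M" "g (?k y) = y" if "y \<in> carrier N" for y
    using that g(2) by (auto intro: inv_into_into f_inv_into_f)
  have map_k: "map ?k ys \<in> tuples (carrier M) n" "map g (map ?k ys) = ys"
    if "ys \<in> tuples (carrier N) n" for ys n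
    using that k by (auto simp: tuples_def intro!: map_idI)
  show ?thesis
    unfolding is_emb_def
  proof (intro conjI ballI)
    show "?k ` carrier N \<subseteq> carrier M" using k by auto
    show "inj_on ?k (carrier N)" using k by (metis inj_onI)
    fix f ys assume f: "f \<in> funs L" and ys: "ys \<in> tuples (carrier N) (farity L f)"
    have "fint N f ys = g (fint M f (map ?k ys))"
      using g(1) f map_k[OF ys] unfolding is_emb_def by metis
    moreover have "fint M f (map ?k ys) \<in> carrier M"
      using M f map_k[OF ys] by (auto simp: closed_struct_def)
    ultimately show "?k (fint N f ys) = fint M f (map ?k ys)" using inj by simp
  next
    fix r ys assume "r \<in> rels L" and ys: "ys \<in> tuples (carrier N) (rarity L r)"
    then show "ys \<in> rint N r \<longleftrightarrow> map ?k ys \<in> rint M r"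
      using g(1) map_k[OF ys] unfolding is_emb_def by metis
  qed
qed

text \<open>
  The copy of \<open>M\<close> along \<open>h\<close>, with the default values that make it a
  structure in the sense of \<open>is_struct\<close>.
\<close>

definition image_struct ::
  "('f, 'r) lang \<Rightarrow> ('a \<Rightarrow> 'b) \<Rightarrow> ('f, 'r, 'a) struct \<Rightarrow> ('f, 'r, 'b) struct" where
  "image_struct L h M = \<lparr>carrier = h ` carrier M,
     fint = (\<lambda>f ys. if f \<in> funs L \<and> ys \<in> tuples (h ` carrier M) (farity L f)
        then h (fint M f (map (inv_into (carrier M) h) ys)) else undefined),
     rint = (\<lambda>r. if r \<in> rels L
        then {ys \<in> tuples (h ` carrier M) (rarity L r). map (inv_into (carrier M) h) ys \<in> rint M r}
        else {})\<rparr>"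

lemma carrier_image_struct [simp]: "carrier (image_struct L h M) = h ` carrier M"
  by (simp add: image_struct_def)

lemma image_struct:
  fixes h :: "'a \<Rightarrow> 'b"
  assumes M: "closed_struct L M" and inj: "inj_on h (carrier M)"
    and card: "|carrier M| <o |UNIV :: 'b set|"
  shows "is_struct L (image_struct L h M)" "is_emb L M h (image_struct L h M)"
proof -
  let ?k = "inv_into (carrier M) h"
  let ?Q = "image_struct L h M"
  have k: "?k y \<in> carrier M" if "y \<in> h ` carrier M" for y
    using that by (rule inv_into_into)
  have k_in: "map ?k ys \<in> tuples (carrier M) n" if "ys \<in> tuples (h ` carrier M) n" for ys n
  proof -
    have "set ys \<subseteq> h ` carrier M" "length ys = n" using that by (auto simp: tuples_def)
    moreover from this have "?k ` set ys \<subseteq> carrier M" using k by (intro image_subsetI) blast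
    ultimately show ?thesis by (simp add: tuples_def)
  qed
  have k_map: "map ?k (map h xs) = xs" "map h xs \<in> tuples (h ` carrier M) n"
    if "xs \<in> tuples (carrier M) n" for xs n
  proof -
    have "set xs \<subseteq> carrier M" "length xs = n" using that by (auto simp: tuples_def)
    then show "map ?k (map h xs) = xs" "map h xs \<in> tuples (h ` carrier M) n"
      using inj unfolding map_map by (auto simp: tuples_def intro!: map_idI)
  qed
  have "|h ` carrier M| <o |UNIV :: 'b set|"
    using card card_of_image ordLeq_ordLess_trans by blast
  moreover have "fint ?Q f ys \<in> h ` carrier M"
    if "f \<in> funs L" "ys \<in> tuples (h ` carrier M) (farity L f)" for f ys
    using M that k_in[OF that(2)] by (simp add: image_struct_def closed_struct_def)
  moreover have "fint ?Q f ys = undefined"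
    if "\<not> (f \<in> funs L \<and> ys \<in> tuples (h ` carrier M) (farity L f))" for f ys
    using that by (auto simp: image_struct_def)
  moreover have "rint ?Q r \<subseteq> tuples (h ` carrier M) (rarity L r)" if "r \<in> rels L" for r
    using that by (simp add: image_struct_def)
  moreover have "rint ?Q r = {}" if "r \<notin> rels L" for r
    using that by (simp add: image_struct_def)
  moreover have "h ` carrier M \<noteq> {}" using M by (simp add: closed_struct_def)
  ultimately show "is_struct L ?Q"
    unfolding is_struct_def small_def by simp
  show "is_emb L M h ?Q"
    unfolding is_emb_def
  proof (intro conjI ballI)
    fix f xs assume "f \<in> funs L" "xs \<in> tuples (carrier M) (farity L f)"
    then show "h (fint M f xs) = fint ?Q f (map h xs)"
      using k_map[of xs "farity L f"] by (simp add: image_struct_def del: map_map)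
  next
    fix r xs assume "r \<in> rels L" "xs \<in> tuples (carrier M) (rarity L r)"
    then show "xs \<in> rint M r \<longleftrightarrow> map h xs \<in> rint ?Q r"
      using k_map[of xs "rarity L r"] by (simp add: image_struct_def del: map_map)
  qed (use inj in auto)
qed

lemma card_of_Compl_small:
  fixes A :: "'u set"
  assumes "|A| <o |UNIV :: 'u set|" "infinite (UNIV :: 'u set)"
  shows "|UNIV :: 'u set| \<le>o |- A|"
proof (rule ccontr)
  assume "\<not> ?thesis"
  then have "|- A| <o |UNIV :: 'u set|"
    using card_of_Well_order[of "- A"] card_of_Well_order[of "UNIV :: 'u set"]
      not_ordLeq_iff_ordLess by blast
  then have "|A \<union> - A| <o |UNIV :: 'u set|"
    using card_of_Un_ordLess_infinite[OF assms(2,1)] by blast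
  then show False by (simp add: ordLess_irreflexive)
qed

text \<open>
  A structure into which \<open>N\<close> embeds can be replaced by a copy that is an actual
  extension of \<open>N\<close>: elements in the range of \<open>j\<close> get their old names,
  and there are enough names outside the small set \<open>carrier N\<close> for the others.
\<close>

lemma extend_along_embedding:
  fixes N :: "('f, 'r, 'u) struct" and P :: "('f, 'r, 'p) struct"
  assumes N: "is_struct L N" and P: "closed_struct L P" and j: "is_emb L N j P"
    and card: "|carrier P| <o |UNIV :: 'u set|" and inf: "infinite (UNIV :: 'u set)"
  obtains N' g where "substructure L N N'" "is_emb L P g N'" "g ` carrier P = carrier N'"
    "\<forall>c \<in> carrier N. g (j c) = c"
proof -
  let ?J = "j ` carrier N"
  have inj_j: "inj_on j (carrier N)" using j by (simp add: is_emb_def)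
  have "|carrier P - ?J| \<le>o |carrier P|" by (simp add: card_of_mono1)
  also have "|carrier P| \<le>o |UNIV :: 'u set|" by (rule ordLess_imp_ordLeq[OF card])
  also have "|UNIV :: 'u set| \<le>o |- carrier N|"
    using N inf by (intro card_of_Compl_small) (auto simp: is_struct_def small_def)
  finally obtain k where k: "inj_on k (carrier P - ?J)" "k ` (carrier P - ?J) \<subseteq> - carrier N"
    unfolding card_of_ordLeq[symmetric] by blast
  define g where "g x = (if x \<in> ?J then inv_into (carrier N) j x else k x)" for x
  have gj: "g (j c) = c" if "c \<in> carrier N" for c
    using that inj_j by (simp add: g_def)
  have g_J: "g x \<in> carrier N \<longleftrightarrow> x \<in> ?J" if "x \<in> carrier P" for x
    using that k gj by (auto simp: g_def)
  have inj_g: "inj_on g (carrier P)"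
  proof (rule inj_onI)
    fix x y assume xy: "x \<in> carrier P" "y \<in> carrier P" "g x = g y"
    show "x = y"
    proof (cases "x \<in> ?J")
      case True
      then have "y \<in> ?J" using xy g_J by metis
      with True xy(3) gj show ?thesis by auto
    next
      case False
      then have "y \<notin> ?J" using xy g_J by metis
      with False xy k(1) show ?thesis by (auto simp: g_def dest: inj_onD)
    qed
  qed
  note Q = image_struct[OF P inj_g card]
  have "is_emb L N (\<lambda>x. x) (image_struct L g P)"
    using is_emb_cong[OF is_emb_comp[OF j Q(2) is_struct_closed[OF N]] is_struct_closed[OF N], of "\<lambda>x. x"] gj by simp
  then have "substructure L N (image_struct L g P)"
    using N Q(1) by (simp add: substructure_iff_is_emb)
  then show thesis using that[of "image_struct L g P" g] Q(2) gj by simp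
qed

section \<open>Amalgamation over a common type\<close>

definition same_type ::
  "('f, 'r) lang \<Rightarrow> ('f, 'r, 'a) struct \<Rightarrow> 'a list \<Rightarrow> ('f, 'r, 'b) struct \<Rightarrow> 'b list \<Rightarrow> bool" where
  "same_type L M a N b \<longleftrightarrow> length a = length b \<and>
     (\<forall>\<phi> \<in> formulas L (length a). sat_tuple M a \<phi> \<longleftrightarrow> sat_tuple N b \<phi>)"

lemma same_type_sym: "same_type L M a N b \<Longrightarrow> same_type L N b M a"
  by (auto simp: same_type_def)

lemma sat_tuple_eq_sat:
  assumes "\<phi> \<in> formulas L (length a)" "\<And>i. i < length a \<Longrightarrow> e i = a ! i"
  shows "sat_tuple M a \<phi> \<longleftrightarrow> sat M e \<phi>"
  unfolding sat_tuple_def by (rule sat_cong) (use assms in \<open>auto simp: formulas_def\<close>)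

lemma sat_tuple_Exists:
  assumes "\<phi> \<in> formulas L (Suc (length a))"
  shows "Exists (length a) \<phi> \<in> formulas L (length a)"
    "sat_tuple M a (Exists (length a) \<phi>) \<longleftrightarrow> (\<exists>c \<in> carrier M. sat_tuple M (a @ [c]) \<phi>)"
proof -
  show "Exists (length a) \<phi> \<in> formulas L (length a)"
    using assms by (auto simp: formulas_def less_Suc_eq)
  have "sat_tuple M (a @ [c]) \<phi> \<longleftrightarrow> sat M (((!) a)(length a := c)) \<phi>" for c
    by (rule sat_tuple_eq_sat) (use assms in \<open>auto simp: nth_append\<close>)
  then show "sat_tuple M a (Exists (length a) \<phi>) \<longleftrightarrow> (\<exists>c \<in> carrier M. sat_tuple M (a @ [c]) \<phi>)"
    by (simp add: sat_tuple_def)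
qed

text \<open>
  The empty conjunction is a sentence, true in all nonempty structures, so that it lies in every
  set \<open>formulas L n\<close>, also for \<open>n = 0\<close>.
\<close>

fun Conjs :: "('f, 'r) fm list \<Rightarrow> ('f, 'r) fm" where
  "Conjs [] = Exists 0 (Eq (Var 0) (Var 0))"
| "Conjs (\<phi> # \<phi>s) = Conj \<phi> (Conjs \<phi>s)"

lemma Conjs_in_formulas: "set \<phi>s \<subseteq> formulas L n \<Longrightarrow> Conjs \<phi>s \<in> formulas L n"
  by (induction \<phi>s) (auto simp: formulas_def)

lemma sat_tuple_Conjs:
  "carrier M \<noteq> {} \<Longrightarrow> sat_tuple M a (Conjs \<phi>s) \<longleftrightarrow> (\<forall>\<phi> \<in> set \<phi>s. sat_tuple M a \<phi>)"
  by (induction \<phi>s) (auto simp: sat_tuple_def)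

text \<open>
  Quantifying over the last element of \<open>cs\<close> gives a formula about a shorter tuple.
\<close>

lemma same_type_extend_tuple:
  assumes "same_type L M a N b" "set cs \<subseteq> carrier N"
    "\<theta> \<in> formulas L (length b + length cs)" "sat_tuple N (b @ cs) \<theta>"
  shows "\<exists>ds. length ds = length cs \<and> set ds \<subseteq> carrier M \<and> sat_tuple M (a @ ds) \<theta>"
  using assms(2-)
proof (induction cs arbitrary: \<theta> rule: rev_induct)
  case Nil
  then show ?case using assms(1) by (auto simp: same_type_def)
next
  case (snoc c cs)
  let ?\<theta> = "Exists (length (b @ cs)) \<theta>"
  have len: "length a = length b" using assms(1) by (simp add: same_type_def)
  have \<theta>: "\<theta> \<in> formulas L (Suc (length (b @ cs)))" using snoc.prems by simp
  have "sat_tuple N (b @ cs) ?\<theta>"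
    using snoc.prems sat_tuple_Exists(2)[OF \<theta>] by auto
  then obtain ds where ds: "length ds = length cs" "set ds \<subseteq> carrier M" "sat_tuple M (a @ ds) ?\<theta>"
    using snoc.IH[of ?\<theta>] sat_tuple_Exists(1)[OF \<theta>] snoc.prems by auto
  then have "length (b @ cs) = length (a @ ds)" using len by simp
  then obtain d where "d \<in> carrier M" "sat_tuple M ((a @ ds) @ [d]) \<theta>"
    using ds(3) \<theta> sat_tuple_Exists(2)[of \<theta> L "a @ ds" M] by auto
  then show ?case using ds by (intro exI[of _ "ds @ [d]"]) auto
qed

fun ren_tm :: "(nat \<Rightarrow> nat) \<Rightarrow> 'f tm \<Rightarrow> 'f tm" where
  "ren_tm s (Var i) = Var (s i)"
| "ren_tm s (App f ts) = App f (map (ren_tm s) ts)"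

fun ren_atom :: "(nat \<Rightarrow> nat) \<Rightarrow> ('f, 'r) fm \<Rightarrow> ('f, 'r) fm" where
  "ren_atom s (Eq t u) = Eq (ren_tm s t) (ren_tm s u)"
| "ren_atom s (Rel r ts) = Rel r (map (ren_tm s) ts)"
| "ren_atom s \<phi> = \<phi>"

lemma ren_tm:
  "tm_val M e (ren_tm s t) = tm_val M (e \<circ> s) t" "wf_tm L (ren_tm s t) = wf_tm L t"
  "fv_tm (ren_tm s t) = s ` fv_tm t"
  by (induction t) (auto simp: comp_def intro!: arg_cong[of _ _ "fint M _"])

lemma ren_atom:
  assumes "is_atomic \<phi>"
  shows "sat M e (ren_atom s \<phi>) \<longleftrightarrow> sat M (e \<circ> s) \<phi>" "wf_fm L (ren_atom s \<phi>) = wf_fm L \<phi>"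
    "fv (ren_atom s \<phi>) = s ` fv \<phi>"
proof -
  have "map (tm_val M e \<circ> ren_tm s) ts = map (tm_val M (e \<circ> s)) ts" for ts
    by (simp add: ren_tm)
  then show "sat M e (ren_atom s \<phi>) \<longleftrightarrow> sat M (e \<circ> s) \<phi>"
    using assms by (cases \<phi>) (simp_all add: ren_tm del: map_eq_conv)
  show "wf_fm L (ren_atom s \<phi>) = wf_fm L \<phi>" using assms by (cases \<phi>) (auto simp: ren_tm)
  show "fv (ren_atom s \<phi>) = s ` fv \<phi>" using assms by (cases \<phi>) (auto simp: ren_tm)
qed

text \<open>
  The elements mentioned by \<open>Q\<close>, listed after \<open>b\<close>, satisfy the
  conjunction of the literals that record the truth values of the formulas in \<open>Q\<close>,
  with variables renamed to positions in the list. By equality of types this conjunction is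
  satisfied in \<open>M\<close> over \<open>a\<close>, and \<open>h\<close> reads off the values.
\<close>

lemma finite_diagram_realized:
  assumes type: "same_type L M a N b" and M: "closed_struct L M" and N: "carrier N \<noteq> {}"
    and a: "set a \<subseteq> carrier M" and b: "set b \<subseteq> carrier N" and Q: "finite Q"
    and atoms: "\<And>\<phi> e. (\<phi>, e) \<in> Q \<Longrightarrow> is_atomic \<phi> \<and> wf_fm L \<phi> \<and> range e \<subseteq> carrier N"
  obtains h where "range h \<subseteq> carrier M" "map h b = a"
    "\<And>\<phi> e. (\<phi>, e) \<in> Q \<Longrightarrow> sat M (h \<circ> e) \<phi> \<longleftrightarrow> sat N e \<phi>"
proof -
  obtain m where m: "m \<in> carrier M" using M by (auto simp: closed_struct_def)
  have len: "length a = length b" using type by (simp add: same_type_def)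
  have "finite (\<Union>(\<phi>, e) \<in> Q. e ` fv \<phi>)"
    by (rule finite_UN_I[OF Q]) (simp add: finite_fv split: prod.split)
  from finite_list[OF this] obtain cs where cs: "set cs = (\<Union>(\<phi>, e) \<in> Q. e ` fv \<phi>)" ..
  define l where "l = b @ cs"
  \<comment> \<open>The least position matters: an element of \<open>b\<close> may occur in
    \<open>cs\<close> again, and must be sent into \<open>a\<close>.\<close>
  define idx where "idx c = (LEAST j. j < length l \<and> l ! j = c)" for c
  have idx: "idx c < length l \<and> l ! idx c = c" if "c \<in> set l" for c
    using that unfolding idx_def in_set_conv_nth by (rule LeastI_ex)
  have idx_b: "idx (b ! j) \<le> j" if "j < length b" for j
    unfolding idx_def by (rule Least_le) (use that in \<open>auto simp: l_def nth_append\<close>)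
  define lit where "lit = (\<lambda>(\<phi>, e). if sat N e \<phi> then ren_atom (idx \<circ> e) \<phi> else Neg (ren_atom (idx \<circ> e) \<phi>))"
  have e_l: "e k \<in> set l" if "(\<phi>, e) \<in> Q" "k \<in> fv \<phi>" for \<phi> e k
    using that cs unfolding l_def by force
  have lit_wf: "lit q \<in> formulas L (length l)" if "q \<in> Q" for q
  proof -
    obtain \<phi> e where q: "q = (\<phi>, e)" by (cases q)
    have "is_atomic \<phi>" "wf_fm L \<phi>" using atoms[of \<phi> e] that q by auto
    moreover have "idx (e k) < length l" if "k \<in> fv \<phi>" for k
      using idx e_l[of \<phi> e k] that \<open>q \<in> Q\<close> q by auto
    ultimately show ?thesis by (auto simp: q lit_def formulas_def ren_atom)
  qed
  have "sat N ((!) l \<circ> (idx \<circ> e)) \<phi> \<longleftrightarrow> sat N e \<phi>" if "(\<phi>, e) \<in> Q" for \<phi> e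
    by (rule sat_cong) (use idx e_l[OF that] in auto)
  then have lit_sat: "sat_tuple N l (lit q)" if "q \<in> Q" for q
    using that atoms by (auto simp: lit_def sat_tuple_def ren_atom split: prod.splits)
  obtain qs where qs: "set qs = lit ` Q" using Q finite_list[of "lit ` Q"] by auto
  have cs_N: "set cs \<subseteq> carrier N"
  proof
    fix c assume "c \<in> set cs"
    then obtain \<phi> e k where "(\<phi>, e) \<in> Q" "c = e k" using cs by auto
    then show "c \<in> carrier N" using atoms[of \<phi> e] by auto
  qed
  have "\<exists>ds. length ds = length cs \<and> set ds \<subseteq> carrier M \<and> sat_tuple M (a @ ds) (Conjs qs)"
  proof (rule same_type_extend_tuple[OF type cs_N])
    show "Conjs qs \<in> formulas L (length b + length cs)"
      using Conjs_in_formulas[of qs L "length l"] image_subsetI[of Q lit, OF lit_wf] qs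
      by (simp add: l_def)
    show "sat_tuple N (b @ cs) (Conjs qs)"
      using sat_tuple_Conjs[OF N] lit_sat qs by (auto simp: l_def)
  qed
  then obtain ds where ds: "length ds = length cs" "set ds \<subseteq> carrier M"
    and "sat_tuple M (a @ ds) (Conjs qs)" by blast
  then have sat_lit: "sat_tuple M (a @ ds) (lit q)" if "q \<in> Q" for q
    using sat_tuple_Conjs[of M "a @ ds" qs] m qs that by auto
  define h where "h c = (if c \<in> set l then (a @ ds) ! idx c else m)" for c
  have "(a @ ds) ! idx c \<in> carrier M" if "c \<in> set l" for c
    using nth_mem[of "idx c" "a @ ds"] idx[OF that] a ds len by (auto simp: l_def simp del: nth_mem)
  then have "range h \<subseteq> carrier M" using m by (auto simp: h_def)
  moreover have "map h b = a"
  proof (rule nth_equalityI)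
    fix j assume "j < length (map h b)"
    then have j: "j < length b" by simp
    then have bj: "b ! j \<in> set l" by (auto simp: l_def)
    define k where "k = idx (b ! j)"
    have k: "k < length b" "k \<le> j" using idx_b[OF j] j by (auto simp: k_def)
    \<comment> \<open>If \<open>b\<close> has repetitions then so does \<open>a\<close>, by equality of types,
      so that \<open>h\<close> sends all of \<open>b\<close> to \<open>a\<close>.\<close>
    then have "b ! k = b ! j" using idx[OF bj] j by (auto simp: l_def nth_append k_def)
    then have "sat_tuple N b (Eq (Var k) (Var j))" by (simp add: sat_tuple_def)
    moreover have "Eq (Var k) (Var j) \<in> formulas L (length a)" using k j len by (simp add: formulas_def)
    ultimately have "sat_tuple M a (Eq (Var k) (Var j))" using type by (simp add: same_type_def)
    then show "map h b ! j = a ! j"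
      using j bj k len by (simp add: h_def k_def[symmetric] sat_tuple_def nth_append)
  qed (simp add: len)
  moreover have "sat M (h \<circ> e) \<phi> \<longleftrightarrow> sat N e \<phi>" if q: "(\<phi>, e) \<in> Q" for \<phi> e
  proof -
    have "sat M (h \<circ> e) \<phi> \<longleftrightarrow> sat M ((!) (a @ ds) \<circ> (idx \<circ> e)) \<phi>"
      by (rule sat_cong) (use e_l[OF q] in \<open>auto simp: h_def\<close>)
    also have "\<dots> \<longleftrightarrow> sat_tuple M (a @ ds) (ren_atom (idx \<circ> e) \<phi>)"
      using atoms[OF q] by (simp add: sat_tuple_def ren_atom)
    also have "\<dots> \<longleftrightarrow> sat N e \<phi>"
      using sat_lit[OF q] by (auto simp: lit_def sat_tuple_def split: if_splits)
    finally show ?thesis .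
  qed
  ultimately show thesis using that by blast
qed

text \<open>
  The ultrapower of \<open>M'\<close> over maps \<open>h\<close>, thought of as maps from
  \<open>N\<close> to \<open>M'\<close>, with the evaluations \<open>h \<mapsto> h c\<close> as
  the images of the elements \<open>c\<close> of \<open>N\<close>. The ultrafilter contains, for
  each atomic formula and assignment into \<open>N\<close>, the set of maps that send
  \<open>b\<close> to \<open>a\<close> and preserve the truth value of that formula. By
  \<open>Los\<close>, the image of \<open>b\<close> has the type of \<open>a\<close> in
  \<open>M'\<close>.
\<close>

lemma exists_ultrapower_over_type:
  fixes N :: "('f, 'r, 'u) struct" and M M' :: "('f, 'r, 'u) struct"
  assumes type: "same_type L M a N b" and sub: "is_emb L M (\<lambda>x. x) M'"
    and M: "closed_struct L M" and M': "closed_struct L M'" and N: "carrier N \<noteq> {}"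
    and a: "set a \<subseteq> carrier M" and b: "set b \<subseteq> carrier N"
  obtains P :: "('f, 'r, ('u \<Rightarrow> 'u) \<Rightarrow> 'u) struct" and j
    where "closed_struct L P" "j ` carrier N \<subseteq> carrier P"
    "\<And>\<phi> e. is_atomic \<phi> \<Longrightarrow> wf_fm L \<phi> \<Longrightarrow> range e \<subseteq> carrier N \<Longrightarrow>
      sat P (j \<circ> e) \<phi> \<longleftrightarrow> sat N e \<phi>"
    "same_type L M' a P (map j b)"
proof -
  obtain m where m: "m \<in> carrier M" using M by (auto simp: closed_struct_def)
  have MM': "carrier M \<subseteq> carrier M'" using sub by (auto simp: is_emb_def)
  have len: "length a = length b" using type by (simp add: same_type_def)
  \<comment> \<open>The index type consists of all maps from the universe to itself; \<open>cl\<close>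
    forces their values into \<open>M'\<close>.\<close>
  define cl where "cl x = (if x \<in> carrier M' then x else m)" for x
  define Q :: "(('f, 'r) fm \<times> (nat \<Rightarrow> 'u)) set" where "Q = {(\<phi>, e). is_atomic \<phi> \<and> wf_fm L \<phi> \<and> range e \<subseteq> carrier N}"
  define S where "S = (\<lambda>(\<phi>, e). {h. map h b = a \<and> (sat M' (cl \<circ> (h \<circ> e)) \<phi> \<longleftrightarrow> sat N e \<phi>)})"
  have cl_M': "cl x \<in> carrier M'" for x using m MM' by (auto simp: cl_def)
  have nonempty: "(\<Inter>q \<in> X. S q) \<noteq> {}" if X: "finite X" "X \<subseteq> Q"
    for X :: "(('f, 'r) fm \<times> (nat \<Rightarrow> 'u)) set"
  proof -
    have "\<And>\<phi> e. (\<phi>, e) \<in> X \<Longrightarrow> is_atomic \<phi> \<and> wf_fm L \<phi> \<and> range e \<subseteq> carrier N"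
      using X by (auto simp: Q_def)
    then obtain h where h: "range h \<subseteq> carrier M" "map h b = a"
      and sat: "\<And>\<phi> e. (\<phi>, e) \<in> X \<Longrightarrow> sat M (h \<circ> e) \<phi> \<longleftrightarrow> sat N e \<phi>"
      using finite_diagram_realized[OF type M N a b X(1)] by blast
    have "h \<in> S q" if q: "q \<in> X" for q
    proof -
      obtain \<phi> e where q_eq: "q = (\<phi>, e)" by (cases q)
      then have \<phi>: "is_atomic \<phi>" "wf_fm L \<phi>" using X q by (auto simp: Q_def)
      have "range (h \<circ> e) \<subseteq> carrier M" using h(1) by auto
      then have "sat M' ((\<lambda>x. x) \<circ> (h \<circ> e)) \<phi> \<longleftrightarrow> sat M (h \<circ> e) \<phi>"
        by (intro sat_atomic_is_emb[OF sub M] \<phi>)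
      moreover have "(\<lambda>x. x) \<circ> (h \<circ> e) = cl \<circ> (h \<circ> e)"
        using h(1) MM' by (auto simp: cl_def fun_eq_iff)
      ultimately show ?thesis using h(2) sat q by (simp add: S_def q_eq)
    qed
    then show ?thesis by blast
  qed
  define F0 where "F0 = (INF q \<in> Q. principal (S q))"
  have "F0 \<noteq> bot"
  proof
    assume "F0 = bot"
    then have "eventually (\<lambda>_. False) F0" by simp
    then have "\<exists>X \<subseteq> Q. finite X \<and> eventually (\<lambda>_. False) (INF q \<in> X. principal (S q))"
      unfolding F0_def by (rule eventually_INF[THEN iffD1])
    then obtain X where X: "X \<subseteq> Q" "finite X" "eventually (\<lambda>_. False) (INF q \<in> X. principal (S q))"
      by blast
    then show False
      using nonempty[of X] unfolding INF_principal_finite[OF X(2)] eventually_principal by auto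
  qed
  then obtain U where U: "U \<le> F0" "ultra U" by (rule ultra_exists)
  have ev: "\<forall>\<^sub>F h in U. h \<in> S q" if "q \<in> Q" for q
  proof -
    have "U \<le> principal (S q)" using U(1) that unfolding F0_def by (meson INF_lower order_trans)
    then show ?thesis by (simp add: le_principal)
  qed
  define P where "P = ultrapower L U M'"
  define j where "j c = up_rep (carrier M') U (\<lambda>h. cl (h c))" for c
  have cl_range: "range (\<lambda>h. cl (h c)) \<subseteq> carrier M'" for c using cl_M' by auto
  have j_P: "j c \<in> carrier P" for c
    unfolding j_def P_def by (rule up_rep_in_carrier[OF cl_range])
  have j_ev: "\<forall>\<^sub>F h in U. cl (h c) = j c h" for c
    unfolding j_def by (rule up_rep(2)[OF cl_range])
  have atomic: "sat P (j \<circ> e) \<phi> \<longleftrightarrow> sat N e \<phi>"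
    if \<phi>: "is_atomic \<phi>" "wf_fm L \<phi>" "range e \<subseteq> carrier N" for \<phi> e
  proof -
    have "sat P (j \<circ> e) \<phi> \<longleftrightarrow> (\<forall>\<^sub>F h in U. sat M' (\<lambda>k. (j \<circ> e) k h) \<phi>)"
      unfolding P_def by (rule Los[OF U(2) M' \<phi>(2)]) (use j_P P_def in auto)
    also have "\<dots> \<longleftrightarrow> (\<forall>\<^sub>F h in U. sat N e \<phi>)"
    proof (rule eventually_cong_eventually)
      have "\<forall>\<^sub>F h in U. \<forall>k \<in> fv \<phi>. cl (h (e k)) = j (e k) h"
        using j_ev by (intro eventually_ball_finite finite_fv) auto
      moreover have "\<forall>\<^sub>F h in U. h \<in> S (\<phi>, e)" using \<phi> by (intro ev) (auto simp: Q_def)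
      ultimately show "\<forall>\<^sub>F h in U. sat M' (\<lambda>k. (j \<circ> e) k h) \<phi> = sat N e \<phi>"
      proof eventually_elim
        case (elim h)
        have "sat M' (\<lambda>k. (j \<circ> e) k h) \<phi> = sat M' (cl \<circ> (h \<circ> e)) \<phi>"
          by (rule sat_cong) (use elim(1) in auto)
        with elim(2) show ?case by (simp add: S_def)
      qed
    qed
    also have "\<dots> \<longleftrightarrow> sat N e \<phi>" using U(2) by (simp add: ultra_def)
    finally show ?thesis .
  qed
  have "same_type L M' a P (map j b)"
    unfolding same_type_def
  proof (intro conjI ballI)
    fix \<phi> assume \<phi>: "\<phi> \<in> formulas L (length a)"
    define e where "e k = (if k < length b then j (b ! k) else j m)" for k
    have e_P: "range e \<subseteq> carrier P" using j_P by (auto simp: e_def)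
    have "sat_tuple P (map j b) \<phi> \<longleftrightarrow> sat P e \<phi>"
      by (rule sat_tuple_eq_sat) (use \<phi> len in \<open>auto simp: e_def\<close>)
    also have "\<dots> \<longleftrightarrow> (\<forall>\<^sub>F h in U. sat M' (\<lambda>k. e k h) \<phi>)"
      unfolding P_def by (rule Los[OF U(2) M']) (use \<phi> e_P P_def in \<open>auto simp: formulas_def\<close>)
    also have "\<dots> \<longleftrightarrow> (\<forall>\<^sub>F h in U. sat_tuple M' a \<phi>)"
    proof (rule eventually_cong_eventually)
      have "\<forall>\<^sub>F h in U. \<forall>k \<in> {..<length b}. cl (h (b ! k)) = j (b ! k) h"
        using j_ev by (intro eventually_ball_finite) auto
      moreover have "\<forall>\<^sub>F h in U. map h b = a"
      proof (cases "b = []")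
        case True
        then show ?thesis using len by simp
      next
        case False
        \<comment> \<open>Any member of \<open>Q\<close> shows that almost all maps send \<open>b\<close> to
          \<open>a\<close>.\<close>
        then have "(Eq (Var 0) (Var 0), \<lambda>_. b ! 0) \<in> Q" using b by (auto simp: Q_def)
        from ev[OF this] show ?thesis by (auto simp: S_def elim: eventually_mono)
      qed
      ultimately show "\<forall>\<^sub>F h in U. sat M' (\<lambda>k. e k h) \<phi> = sat_tuple M' a \<phi>"
      proof eventually_elim
        case (elim h)
        have "e k h = a ! k" if k: "k < length a" for k
        proof -
          have "h (b ! k) = a ! k" using k len elim(2) by auto
          moreover have "a ! k \<in> carrier M'" using nth_mem[OF k] a MM' by blast
          ultimately show ?thesis using elim(1)[rule_format, of k] k len by (simp add: e_def cl_def)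
        qed
        then show ?case using sat_tuple_eq_sat[OF \<phi>, of "\<lambda>k. e k h"] by blast
      qed
    qed
    also have "\<dots> \<longleftrightarrow> sat_tuple M' a \<phi>" using U(2) by (simp add: ultra_def)
    finally show "sat_tuple M' a \<phi> \<longleftrightarrow> sat_tuple P (map j b) \<phi>" by simp
  qed (simp add: len)
  with atomic j_P show thesis
    using closed_struct_ultrapower[OF M'] that[of P j] by (auto simp: P_def)
qed

lemma sat_tuple_iso:
  assumes "is_emb L M h N" "h ` carrier M = carrier N" "closed_struct L M"
    "set a \<subseteq> carrier M" "\<phi> \<in> formulas L (length a)"
  shows "sat_tuple N (map h a) \<phi> \<longleftrightarrow> sat_tuple M a \<phi>"
proof -
  obtain m where m: "m \<in> carrier M" using assms(3) by (auto simp: closed_struct_def)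
  define e where "e k = (if k < length a then a ! k else m)" for k
  have "sat_tuple N (map h a) \<phi> \<longleftrightarrow> sat N (h \<circ> e) \<phi>"
    by (rule sat_tuple_eq_sat) (use assms in \<open>auto simp: e_def\<close>)
  also have "\<dots> \<longleftrightarrow> sat M e \<phi>"
    by (rule sat_iso[OF assms(1-3)]) (use assms m in \<open>auto simp: formulas_def e_def\<close>)
  also have "\<dots> \<longleftrightarrow> sat_tuple M a \<phi>"
    by (rule sat_tuple_eq_sat[symmetric]) (use assms in \<open>auto simp: e_def\<close>)
  finally show ?thesis .
qed

lemma sat_tuple_elementary:
  assumes "elementary L M N" "carrier M \<noteq> {}" "set a \<subseteq> carrier M" "\<phi> \<in> formulas L (length a)"
  shows "sat_tuple N a \<phi> \<longleftrightarrow> sat_tuple M a \<phi>"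
proof -
  obtain m where m: "m \<in> carrier M" using assms(2) by auto
  define e where "e k = (if k < length a then a ! k else m)" for k
  have e: "range e \<subseteq> carrier M" using assms(3) m by (auto simp: e_def)
  have "sat_tuple N a \<phi> \<longleftrightarrow> sat N e \<phi>"
    by (rule sat_tuple_eq_sat) (use assms in \<open>auto simp: e_def\<close>)
  also have "\<dots> \<longleftrightarrow> sat M e \<phi>"
    using assms(1,4) e unfolding elementary_def formulas_def by blast
  also have "\<dots> \<longleftrightarrow> sat_tuple M a \<phi>"
    by (rule sat_tuple_eq_sat[symmetric]) (use assms in \<open>auto simp: e_def\<close>)
  finally show ?thesis .
qed

text \<open>
  Amalgamation matches the maps of the two systems. It plays the role of compactness together with
  the Loewenheim-Skolem theorem: the diagram of \<open>N\<close> and the type of \<open>a\<close>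
  in \<open>M'\<close>, with \<open>b\<close> in place of \<open>a\<close>, have a common model of
  the size of \<open>N\<close>.
\<close>

lemma extend_to_same_type:
  fixes M M' N :: "('f, 'r, 'u) struct"
  assumes type: "same_type L M a N b" and sub: "substructure L M M'" and N: "is_struct L N"
    and a: "set a \<subseteq> carrier M" and b: "set b \<subseteq> carrier N"
    and inf: "infinite (carrier N)" and L: "|funs L| \<le>o |carrier N|" "|rels L| \<le>o |carrier N|"
  obtains N' where "substructure L N N'" "|carrier N'| =o |carrier N|" "same_type L M' a N' b"
proof -
  have M: "closed_struct L M" and M': "closed_struct L M'" and emb: "is_emb L M (\<lambda>x. x) M'"
    using sub is_struct_closed by (auto simp: substructure_iff_is_emb)
  have N_cl: "closed_struct L N" using N by (rule is_struct_closed)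
  have "Card_order |carrier N|" by (rule card_of_Card_order)
  with inf have C: "Cinfinite |carrier N|" unfolding cinfinite_def Field_card_of by (intro conjI)
  obtain P :: "('f, 'r, ('u \<Rightarrow> 'u) \<Rightarrow> 'u) struct" and j
    where P: "closed_struct L P" and j: "j ` carrier N \<subseteq> carrier P"
    and atomic: "\<And>\<phi> e. is_atomic \<phi> \<Longrightarrow> wf_fm L \<phi> \<Longrightarrow> range e \<subseteq> carrier N \<Longrightarrow>
      sat P (j \<circ> e) \<phi> \<longleftrightarrow> sat N e \<phi>"
    and P_type: "same_type L M' a P (map j b)"
    using exists_ultrapower_over_type[OF type emb M M' _ a b] N_cl unfolding closed_struct_def by blast
  obtain H where H: "j ` carrier N \<subseteq> H" "H \<subseteq> carrier P" "|H| \<le>o |carrier N|"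
    and K: "closed_struct L (restr_struct L P H)" "elementary L (restr_struct L P H) P"
    by (rule downward_Loewenheim_Skolem[OF P C L j card_of_image])
  let ?K = "restr_struct L P H"
  have j_K: "is_emb L N j ?K"
  proof (rule is_embI_atomic[OF N_cl])
    fix \<phi> :: "('f, 'r) fm" and e :: "nat \<Rightarrow> 'u"
    assume \<phi>: "is_atomic \<phi>" "wf_fm L \<phi>" "range e \<subseteq> carrier N"
    then have "range (j \<circ> e) \<subseteq> H" using H(1) by auto
    then have "sat ?K (j \<circ> e) \<phi> \<longleftrightarrow> sat P (j \<circ> e) \<phi>"
      using K(2) \<phi> unfolding elementary_def by auto
    with atomic[OF \<phi>] show "sat ?K (j \<circ> e) \<phi> \<longleftrightarrow> sat N e \<phi>" by simp
  qed (use H in auto)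
  have small: "|carrier N| <o |UNIV :: 'u set|" using N by (simp add: is_struct_def small_def)
  have K_small: "|carrier ?K| <o |UNIV :: 'u set|"
    using ordLeq_ordLess_trans[OF H(3) small] by simp
  have U_inf: "infinite (UNIV :: 'u set)" using inf finite_subset[OF subset_UNIV] by blast
  obtain N' g where N': "substructure L N N'" "is_emb L ?K g N'" "g ` carrier ?K = carrier N'"
    and gj: "\<forall>c \<in> carrier N. g (j c) = c"
    by (rule extend_along_embedding[OF N K(1) j_K K_small U_inf])
  have "|carrier N'| \<le>o |carrier N|"
    using ordLeq_transitive[OF card_of_image[of g H] H(3)] N'(3) by simp
  moreover have "|carrier N| \<le>o |carrier N'|"
    using N'(1) by (intro card_of_mono1) (auto simp: substructure_def)
  ultimately have "|carrier N'| =o |carrier N|" by (simp add: ordIso_iff_ordLeq)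
  moreover have "same_type L M' a N' b"
  proof -
    have jb: "set (map j b) \<subseteq> H" using b H(1) by auto
    have "map g (map j b) = b" using b gj by (auto intro!: map_idI)
    then have "sat_tuple N' b \<phi> \<longleftrightarrow> sat_tuple P (map j b) \<phi>" if "\<phi> \<in> formulas L (length b)" for \<phi>
      using that sat_tuple_iso[OF N'(2,3) K(1), of "map j b" \<phi>]
        sat_tuple_elementary[OF K(2), of "map j b" \<phi>] jb K(1)
      by (auto simp: closed_struct_def simp del: map_map)
    then show ?thesis using P_type by (auto simp: same_type_def)
  qed
  ultimately show thesis using that N'(1) by blast
qed

section \<open>Small elementary submodels and saturation of large models\<close>

lemma sat_tuple_sentence:
  assumes "\<phi> \<in> formulas L 0"
  shows "sat_tuple M a \<phi> \<longleftrightarrow> sat_tuple M [] \<phi>"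
  unfolding sat_tuple_def by (rule sat_cong) (use assms in \<open>auto simp: formulas_def\<close>)

lemma formulas_mono: "m \<le> n \<Longrightarrow> formulas L m \<subseteq> formulas L n"
  by (auto simp: formulas_def)

lemma models_same_type:
  assumes T: "is_theory L T" and M: "M \<in> models L T" and N: "is_struct L N"
    and type: "same_type L M a N b"
  shows "N \<in> models L T"
  unfolding models_def
proof (intro CollectI conjI ballI N)
  fix \<phi> assume "\<phi> \<in> T"
  then have 0: "\<phi> \<in> formulas L 0" and "sat_tuple M [] \<phi>"
    using T M by (auto simp: is_theory_def models_def)
  then have "sat_tuple M a \<phi>" using sat_tuple_sentence[OF 0] by blast
  then have "sat_tuple N b \<phi>"
    using type formulas_mono[of 0 "length a" L] 0 by (auto simp: same_type_def)
  then show "sat_tuple N [] \<phi>" using sat_tuple_sentence[OF 0] by blast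
qed

lemma same_type_iso:
  assumes "is_emb L M h N" "h ` carrier M = carrier N" "closed_struct L M" "set a \<subseteq> carrier M"
  shows "same_type L M a N (map h a)"
  using sat_tuple_iso[OF assms] by (auto simp: same_type_def)

lemma same_type_elementary:
  assumes "elementary L M N" "carrier M \<noteq> {}" "set a \<subseteq> carrier M"
  shows "same_type L M a N a"
  using sat_tuple_elementary[OF assms] by (auto simp: same_type_def)

lemma is_struct_restr_struct:
  assumes M: "is_struct L M" and H: "H \<subseteq> carrier M" and cl: "closed_struct L (restr_struct L M H)"
  shows "is_struct L (restr_struct L M H)" "substructure L (restr_struct L M H) M"
proof -
  let ?K = "restr_struct L M H"
  have "|H| \<le>o |carrier M|" using H by (rule card_of_mono1)
  then have "|H| <o |UNIV :: 'c set|"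
    using M ordLeq_ordLess_trans unfolding is_struct_def small_def by blast
  moreover have "fint ?K f xs = undefined"
    if "\<not> (f \<in> funs L \<and> xs \<in> tuples H (farity L f))" for f xs
    using that by (auto simp: restr_struct_def)
  moreover have "fint ?K f xs \<in> H" if "f \<in> funs L" "xs \<in> tuples H (farity L f)" for f xs
    using cl that by (simp add: closed_struct_def)
  moreover have "rint ?K r \<subseteq> tuples H (rarity L r)" if "r \<in> rels L" for r
    by (auto simp: restr_struct_def)
  moreover have "rint ?K r = {}" if "r \<notin> rels L" for r
    using that by (simp add: restr_struct_def)
  moreover have "H \<noteq> {}" using cl by (simp add: closed_struct_def)
  ultimately show "is_struct L ?K" unfolding is_struct_def small_def by simp
  with M H show "substructure L ?K M"
    unfolding substructure_def by (auto simp: restr_struct_def)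
qed

lemma substructure_within:
  assumes "substructure L M N" "substructure L K N" "carrier M \<subseteq> carrier K"
  shows "substructure L M K"
proof -
  have sub: "tuples (carrier M) n \<subseteq> tuples (carrier K) n" for n
    using assms(3) by (auto simp: tuples_def)
  have "fint M f xs = fint K f xs" if "f \<in> funs L" "xs \<in> tuples (carrier M) (farity L f)" for f xs
    using assms(1,2) that sub[of "farity L f"] by (auto simp: substructure_def)
  moreover have "rint M r = rint K r \<inter> tuples (carrier M) (rarity L r)" if "r \<in> rels L" for r
    using assms(1,2) that sub[of "rarity L r"] by (auto simp: substructure_def)
  ultimately show ?thesis using assms by (simp add: substructure_def)
qed

lemma substructure_trans:
  assumes "substructure L M N" "substructure L N P"
  shows "substructure L M P"
  using assms is_emb_comp[of L M "\<lambda>x. x" N "\<lambda>x. x" P] is_struct_closed[of L M]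
  by (simp add: substructure_iff_is_emb comp_def)

lemma small_elementary_submodel:
  fixes M :: "('f, 'r, 'u) struct"
  assumes T: "is_theory L T" and \<kappa>: "Cinfinite \<kappa>" and L: "|funs L| \<le>o \<kappa>" "|rels L| \<le>o \<kappa>"
    and M: "M \<in> models L T" and X: "X \<subseteq> carrier M" "|X| \<le>o \<kappa>"
  obtains K where "K \<in> models L T" "substructure L K M" "elementary L K M"
    "X \<subseteq> carrier K" "|carrier K| \<le>o \<kappa>"
proof -
  have M_struct: "is_struct L M" using M by (simp add: models_def)
  obtain H where H: "X \<subseteq> H" "H \<subseteq> carrier M" "|H| \<le>o \<kappa>"
    and K: "closed_struct L (restr_struct L M H)" "elementary L (restr_struct L M H) M"
    by (rule downward_Loewenheim_Skolem[OF is_struct_closed[OF M_struct] \<kappa> L X])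
  note K' = is_struct_restr_struct[OF M_struct H(2) K(1)]
  have "same_type L (restr_struct L M H) [] M []"
    using K by (intro same_type_elementary) (auto simp: closed_struct_def)
  then have "restr_struct L M H \<in> models L T"
    using models_same_type[OF T M K'(1)] same_type_sym by blast
  then show thesis using that[of "restr_struct L M H"] K' K H by simp
qed

text \<open>
  A subset of size exactly \<open>\<kappa>\<close> is added to the generators to bound the hull
  from below.
\<close>

lemma elementary_submodel_of_card:
  fixes M :: "('f, 'r, 'u) struct"
  assumes T: "is_theory L T" and \<kappa>: "Cinfinite \<kappa>" and L: "|funs L| \<le>o \<kappa>" "|rels L| \<le>o \<kappa>"
    and M: "M \<in> models L T" "\<kappa> \<le>o |carrier M|" and X: "X \<subseteq> carrier M" "|X| \<le>o \<kappa>"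
  obtains K where "K \<in> models L T" "substructure L K M" "elementary L K M"
    "X \<subseteq> carrier K" "|carrier K| =o \<kappa>"
proof -
  have inf: "infinite (Field \<kappa>)" and card: "Card_order \<kappa>" using \<kappa> by (auto simp: cinfinite_def)
  obtain Y where Y: "Y \<subseteq> carrier M" "\<kappa> =o |Y|"
    using internalize_card_of_ordLeq2[of "Field \<kappa>" "carrier M"] M(2) card_of_Field_ordIso[OF card]
      ordIso_ordLeq_trans ordIso_transitive ordIso_symmetric by meson
  have XY_card: "|X \<union> Y| \<le>o \<kappa>"
    using card_of_Un_ordLeq_infinite_Field[OF inf X(2) _ card] Y(2) ordIso_symmetric
      ordIso_imp_ordLeq by blast
  have XY: "X \<union> Y \<subseteq> carrier M" using X Y by blast
  obtain K where K: "K \<in> models L T" "substructure L K M" "elementary L K M"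
    "X \<union> Y \<subseteq> carrier K" "|carrier K| \<le>o \<kappa>"
    by (rule small_elementary_submodel[OF T \<kappa> L M(1) XY XY_card])
  have "|Y| \<le>o |carrier K|" using K(4) by (intro card_of_mono1) auto
  then have "\<kappa> \<le>o |carrier K|" using Y(2) ordIso_ordLeq_trans by blast
  then have "|carrier K| =o \<kappa>" using K(5) by (simp add: ordIso_iff_ordLeq)
  then show thesis using that K by blast
qed

text \<open>
  That finitely many formulas are jointly realized is one formula about the parameters.
\<close>

lemma same_type_finitely_realized:
  assumes type: "same_type L M a N b" and ne: "carrier N \<noteq> {}"
    and q: "finite q" "q \<subseteq> formulas L (Suc (length a))"
    and c: "c \<in> carrier M" "\<And>\<phi>. \<phi> \<in> q \<Longrightarrow> sat_tuple M (a @ [c]) \<phi>"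
  shows "\<exists>d \<in> carrier N. \<forall>\<phi> \<in> q. sat_tuple N (b @ [d]) \<phi>"
proof -
  have len: "length a = length b" using type by (simp add: same_type_def)
  obtain qs where qs: "set qs = q" using finite_list[OF q(1)] by blast
  have \<theta>: "Conjs qs \<in> formulas L (Suc (length a))" "Conjs qs \<in> formulas L (Suc (length b))"
    using Conjs_in_formulas[of qs L] q qs len by simp_all
  have "sat_tuple M (a @ [c]) (Conjs qs)" using sat_tuple_Conjs[of M "a @ [c]" qs] c qs by blast
  then have "sat_tuple M a (Exists (length a) (Conjs qs))"
    using sat_tuple_Exists(2)[OF \<theta>(1)] c(1) by blast
  then have "sat_tuple N b (Exists (length b) (Conjs qs))"
    using type sat_tuple_Exists(1)[OF \<theta>(1)] len by (simp add: same_type_def)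
  then obtain d where "d \<in> carrier N" "sat_tuple N (b @ [d]) (Conjs qs)"
    using sat_tuple_Exists(2)[OF \<theta>(2)] by blast
  then show ?thesis using sat_tuple_Conjs[OF ne] qs by blast
qed

text \<open>
  Saturation realizes over \<open>b\<close> the type of \<open>c\<close> over \<open>a\<close>. A
  realization of all formulas of a complete type also fails those outside it, since their
  negations belong to it.
\<close>

lemma same_type_realize:
  assumes type: "same_type L M a N b" and N: "aleph0_saturated L N" "carrier N \<noteq> {}"
    and b: "set b \<subseteq> carrier N" and c: "c \<in> carrier M"
  shows "\<exists>d \<in> carrier N. same_type L M (a @ [c]) N (b @ [d])"
proof -
  have len: "length a = length b" using type by (simp add: same_type_def)
  have M: "carrier M \<noteq> {}" using c by blast
  define p where "p = {\<phi> \<in> formulas L (Suc (length b)). sat_tuple M (a @ [c]) \<phi>}"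
  have "\<exists>d \<in> carrier N. \<forall>\<phi> \<in> q. sat_tuple N (b @ [d]) \<phi>" if q: "finite q" "q \<subseteq> p" for q
    by (rule same_type_finitely_realized[OF type N(2) q(1) _ c]) (use q(2) len in \<open>auto simp: p_def\<close>)
  moreover have "p \<subseteq> formulas L (Suc (length b))" by (auto simp: p_def)
  ultimately obtain d where d: "d \<in> carrier N" "\<And>\<phi>. \<phi> \<in> p \<Longrightarrow> sat_tuple N (b @ [d]) \<phi>"
    using N(1) b unfolding aleph0_saturated_def by (metis (no_types, lifting))
  have "sat_tuple M (a @ [c]) \<phi> \<longleftrightarrow> sat_tuple N (b @ [d]) \<phi>"
    if "\<phi> \<in> formulas L (Suc (length b))" for \<phi>
  proof -
    have "Neg \<phi> \<in> formulas L (Suc (length b))" using that by (simp add: formulas_def)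
    then show ?thesis using d(2)[of \<phi>] d(2)[of "Neg \<phi>"] that
      by (auto simp: p_def sat_tuple_def)
  qed
  then have "same_type L M (a @ [c]) N (b @ [d])" using len by (simp add: same_type_def)
  then show ?thesis using d(1) by blast
qed

text \<open>
  A finitely realized set of formulas over \<open>a\<close> is finitely realized in an elementary
  submodel of size \<open>\<kappa>\<close> that contains \<open>a\<close>, hence realized there,
  and by the same element in \<open>M\<close>.
\<close>

lemma aleph0_saturated_if_submodels:
  fixes M :: "('f, 'r, 'u) struct"
  assumes T: "is_theory L T" and \<kappa>: "Cinfinite \<kappa>" and L: "|funs L| \<le>o \<kappa>" "|rels L| \<le>o \<kappa>"
    and sat: "\<And>K :: ('f, 'r, 'u) struct. K \<in> models L T \<Longrightarrow> |carrier K| =o \<kappa> \<Longrightarrow> aleph0_saturated L K"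
    and M: "M \<in> models L T" "\<kappa> \<le>o |carrier M|"
  shows "aleph0_saturated L M"
  unfolding aleph0_saturated_def
proof (intro allI impI, elim conjE)
  fix a p assume a: "set a \<subseteq> carrier M" and p: "p \<subseteq> formulas L (Suc (length a))"
    and fin: "\<forall>q. finite q \<and> q \<subseteq> p \<longrightarrow> (\<exists>c \<in> carrier M. \<forall>\<phi> \<in> q. sat_tuple M (a @ [c]) \<phi>)"
  have "set a = (!) a ` {..<length a}" by (auto simp: set_conv_nth)
  then have a_card: "|set a| \<le>o \<kappa>"
    using card_image_ordLeq[OF countable_ordLeq[OF \<kappa>]] by metis
  obtain K where K: "K \<in> models L T" "substructure L K M" "elementary L K M"
    "set a \<subseteq> carrier K" "|carrier K| =o \<kappa>"
    by (rule elementary_submodel_of_card[OF T \<kappa> L M a a_card])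
  have K_M: "carrier K \<subseteq> carrier M" using K(3) by (simp add: elementary_def)
  have ne: "carrier K \<noteq> {}" "carrier M \<noteq> {}"
    using K(1) M(1) by (auto simp: models_def is_struct_def)
  have type: "same_type L M a K a"
    using same_type_elementary[OF K(3) ne(1) K(4)] by (rule same_type_sym)
  have "\<exists>c \<in> carrier K. \<forall>\<phi> \<in> q. sat_tuple K (a @ [c]) \<phi>" if q: "finite q" "q \<subseteq> p" for q
  proof -
    obtain c where c: "c \<in> carrier M" "\<forall>\<phi> \<in> q. sat_tuple M (a @ [c]) \<phi>"
      using fin[rule_format, OF conjI[OF q]] by auto
    show ?thesis
      by (rule same_type_finitely_realized[OF type ne(1) q(1) _ c(1)]) (use q(2) p c(2) in auto)
  qed
  then have "\<exists>c \<in> carrier K. \<forall>\<phi> \<in> p. sat_tuple K (a @ [c]) \<phi>"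
    using sat[OF K(1,5), unfolded aleph0_saturated_def, rule_format, of a p] K(4) p by simp
  then obtain c where c: "c \<in> carrier K" "\<forall>\<phi> \<in> p. sat_tuple K (a @ [c]) \<phi>" ..
  have "sat_tuple M (a @ [c]) \<phi>" if "\<phi> \<in> p" for \<phi>
    using sat_tuple_elementary[OF K(3) ne(1), of "a @ [c]" \<phi>] c K(4) p that by auto
  then show "\<exists>c \<in> carrier M. \<forall>\<phi> \<in> p. sat_tuple M (a @ [c]) \<phi>" using c(1) K_M by blast
qed

section \<open>Potentialist systems and bisimulations\<close>

lemma is_emb_restrict_id:
  assumes "substructure L M N"
  shows "is_emb L M (restrict (\<lambda>x. x) (carrier M)) N"
  using assms is_emb_cong[of L M "\<lambda>x. x" N "restrict (\<lambda>x. x) (carrier M)"] is_struct_closed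
  by (auto simp: substructure_iff_is_emb)

lemma embedding_restrict_id:
  assumes "substructure L M N"
  shows "embedding L M (restrict (\<lambda>x. x) (carrier M)) N"
  using assms is_emb_restrict_id[OF assms] by (simp add: embedding_iff_is_emb substructure_def)

lemma map_restrict_id: "set a \<subseteq> A \<Longrightarrow> map (restrict (\<lambda>x. x) A) a = a"
  by (intro map_idI) (auto simp: restrict_def)

lemma potentialist_system_inclusions:
  assumes "\<And>M. M \<in> W \<Longrightarrow> is_struct L M"
  shows "potentialist_system L \<lparr>worlds = W,
    maps = {(M, restrict (\<lambda>x. x) (carrier M), N) | M N. M \<in> W \<and> N \<in> W \<and> substructure L M N}\<rparr>"
proof -
  have "substructure L M M" if "M \<in> W" for M
    using assms[OF that] by (auto simp: substructure_iff_is_emb is_emb_def inj_on_def)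
  moreover have "compose (carrier M) (restrict (\<lambda>x. x) (carrier N)) (restrict (\<lambda>x. x) (carrier M)) =
      restrict (\<lambda>x. x) (carrier M)" if "substructure L M N" for M N :: "('a, 'b, 'c) struct"
    using that by (auto simp: compose_def restrict_def substructure_def fun_eq_iff)
  ultimately show ?thesis
    using assms embedding_restrict_id substructure_trans
    unfolding potentialist_system_def by (auto; blast)
qed

lemma Mod_below_eq:
  "Mod_below \<mu> L T = \<lparr>worlds = {M \<in> models L T. |carrier M| <o \<mu>},
     maps = {(M, restrict (\<lambda>x. x) (carrier M), N) | M N.
       M \<in> {M \<in> models L T. |carrier M| <o \<mu>} \<and> N \<in> {M \<in> models L T. |carrier M| <o \<mu>} \<and>
       substructure L M N}\<rparr>"
  unfolding Mod_below_def Mod_def Let_def by auto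

lemma potentialist_system_Mod: "potentialist_system L (Mod L T)"
  unfolding Mod_def by (rule potentialist_system_inclusions) (simp add: models_def)

lemma potentialist_system_Mod_below: "potentialist_system L (Mod_below \<mu> L T)"
  unfolding Mod_below_eq by (rule potentialist_system_inclusions) (simp add: models_def)

lemma potentialist_system_embeddings:
  assumes "\<And>M. M \<in> W \<Longrightarrow> is_struct L M"
  shows "potentialist_system L \<lparr>worlds = W,
    maps = {(M, \<pi>, N). M \<in> W \<and> N \<in> W \<and> embedding L M \<pi> N}\<rparr>"
proof -
  have "embedding L M (restrict (\<lambda>x. x) (carrier M)) M" if "M \<in> W" for M
    using assms[OF that]
    by (intro embedding_restrict_id) (auto simp: substructure_iff_is_emb is_emb_def inj_on_def)
  moreover have "embedding L M (compose (carrier M) \<rho> \<pi>) P"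
    if "embedding L M \<pi> N" "embedding L N \<rho> P" for M N P :: "('a, 'b, 'c) struct" and \<pi> \<rho>
  proof -
    have M: "is_struct L M" and emb: "is_emb L M \<pi> N" "is_emb L N \<rho> P"
      using that by (auto simp: embedding_iff_is_emb)
    from is_emb_cong[OF is_emb_comp[OF emb is_struct_closed[OF M]] is_struct_closed[OF M]]
    have "is_emb L M (compose (carrier M) \<rho> \<pi>) P" by (simp add: compose_def)
    then show ?thesis using that by (auto simp: embedding_iff_is_emb compose_def)
  qed
  ultimately show ?thesis using assms unfolding potentialist_system_def by auto
qed

lemma bisimulationD:
  assumes "bisimulation L S S' R" "R M a N b"
  shows "pointed S M a" "pointed S' N b" "length a = length b"
    "\<And>\<phi>. \<phi> \<in> formulas L (length a) \<Longrightarrow> is_atomic \<phi> \<Longrightarrow> sat_tuple M a \<phi> \<longleftrightarrow> sat_tuple N b \<phi>"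
    "\<And>c. c \<in> carrier M \<Longrightarrow> \<exists>d \<in> carrier N. R M (a @ [c]) N (b @ [d])"
    "\<And>d. d \<in> carrier N \<Longrightarrow> \<exists>c \<in> carrier M. R M (a @ [c]) N (b @ [d])"
    "\<And>\<pi> M'. (M, \<pi>, M') \<in> maps S \<Longrightarrow> \<exists>\<rho> N'. (N, \<rho>, N') \<in> maps S' \<and> R M' (map \<pi> a) N' (map \<rho> b)"
    "\<And>\<rho> N'. (N, \<rho>, N') \<in> maps S' \<Longrightarrow> \<exists>\<pi> M'. (M, \<pi>, M') \<in> maps S \<and> R M' (map \<pi> a) N' (map \<rho> b)"
  using assms unfolding bisimulation_def by blast+

lemma bisimulationI:
  assumes "\<exists>M a N b. R M a N b"
    and "\<And>M a N b. R M a N b \<Longrightarrow> pointed S M a"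
    and "\<And>M a N b. R M a N b \<Longrightarrow> pointed S' N b"
    and "\<And>M a N b. R M a N b \<Longrightarrow> length a = length b"
    and "\<And>M a N b \<phi>. R M a N b \<Longrightarrow> \<phi> \<in> formulas L (length a) \<Longrightarrow> is_atomic \<phi> \<Longrightarrow>
      sat_tuple M a \<phi> \<longleftrightarrow> sat_tuple N b \<phi>"
    and "\<And>M a N b c. R M a N b \<Longrightarrow> c \<in> carrier M \<Longrightarrow> \<exists>d \<in> carrier N. R M (a @ [c]) N (b @ [d])"
    and "\<And>M a N b d. R M a N b \<Longrightarrow> d \<in> carrier N \<Longrightarrow> \<exists>c \<in> carrier M. R M (a @ [c]) N (b @ [d])"
    and "\<And>M a N b \<pi> M'. R M a N b \<Longrightarrow> (M, \<pi>, M') \<in> maps S \<Longrightarrow>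
      \<exists>\<rho> N'. (N, \<rho>, N') \<in> maps S' \<and> R M' (map \<pi> a) N' (map \<rho> b)"
    and "\<And>M a N b \<rho> N'. R M a N b \<Longrightarrow> (N, \<rho>, N') \<in> maps S' \<Longrightarrow>
      \<exists>\<pi> M'. (M, \<pi>, M') \<in> maps S \<and> R M' (map \<pi> a) N' (map \<rho> b)"
  shows "bisimulation L S S' R"
  unfolding bisimulation_def using assms by (intro conjI allI impI ballI) simp_all

lemma bitotally_bisimilar_trans:
  assumes "bitotally_bisimilar L S1 S2" "bitotally_bisimilar L S2 S3"
  shows "bitotally_bisimilar L S1 S3"
proof -
  obtain R1 where R1: "bisimulation L S1 S2 R1" "bitotal S1 S2 R1"
    using assms(1) by (auto simp: bitotally_bisimilar_def)
  obtain R2 where R2: "bisimulation L S2 S3 R2" "bitotal S2 S3 R2"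
    using assms(2) by (auto simp: bitotally_bisimilar_def)
  note D1 = bisimulationD[OF R1(1)] and D2 = bisimulationD[OF R2(1)]
  define R where "R M a P c \<longleftrightarrow> (\<exists>N b. R1 M a N b \<and> R2 N b P c)" for M a P c
  have tot: "\<exists>P c. R2 N b P c" if "pointed S2 N b" for N b
    using R2(2) that by (auto simp: bitotal_def)
  have tot': "\<exists>M a. R1 M a N b" if "pointed S2 N b" for N b
    using R1(2) that by (auto simp: bitotal_def)
  have "bisimulation L S1 S3 R"
  proof (rule bisimulationI)
    obtain M a N b where "R1 M a N b" using R1(1) by (auto simp: bisimulation_def)
    then show "\<exists>M a P c. R M a P c" using D1(2) tot unfolding R_def by blast
  next
    fix M a P c assume "R M a P c"
    then obtain N b where R: "R1 M a N b" "R2 N b P c" by (auto simp: R_def)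
    show "pointed S1 M a" "pointed S3 P c" "length a = length c"
      using R D1(1) D2(2) D1(3) D2(3) by metis+
    show "sat_tuple M a \<phi> \<longleftrightarrow> sat_tuple P c \<phi>" if "\<phi> \<in> formulas L (length a)" "is_atomic \<phi>" for \<phi>
      using D1(3,4)[OF R(1)] D2(4)[OF R(2)] that by metis
    show "\<exists>d \<in> carrier P. R M (a @ [x]) P (c @ [d])" if "x \<in> carrier M" for x
      using D1(5)[OF R(1) that] D2(5)[OF R(2)] unfolding R_def by blast
    show "\<exists>x \<in> carrier M. R M (a @ [x]) P (c @ [d])" if "d \<in> carrier P" for d
      using D2(6)[OF R(2) that] D1(6)[OF R(1)] unfolding R_def by blast
    show "\<exists>\<rho> P'. (P, \<rho>, P') \<in> maps S3 \<and> R M' (map \<pi> a) P' (map \<rho> c)" if "(M, \<pi>, M') \<in> maps S1" for \<pi> M'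
      using D1(7)[OF R(1) that] D2(7)[OF R(2)] unfolding R_def by blast
    show "\<exists>\<pi> M'. (M, \<pi>, M') \<in> maps S1 \<and> R M' (map \<pi> a) P' (map \<rho> c)" if "(P, \<rho>, P') \<in> maps S3" for \<rho> P'
      using D2(8)[OF R(2) that] D1(8)[OF R(1)] unfolding R_def by blast
  qed
  moreover have "bitotal S1 S3 R"
    unfolding bitotal_def
  proof (intro conjI allI impI)
    fix M a assume "pointed S1 M a"
    then obtain N b where "R1 M a N b" using R1(2) unfolding bitotal_def by blast
    then show "\<exists>P c. R M a P c" using D1(2) tot unfolding R_def by blast
  next
    fix P c assume "pointed S3 P c"
    then obtain N b where "R2 N b P c" using R2(2) unfolding bitotal_def by blast
    then show "\<exists>M a. R M a P c" using D2(1) tot' unfolding R_def by blast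
  qed
  ultimately show ?thesis using assms by (auto simp: bitotally_bisimilar_def)
qed

section \<open>Reduction to models of size at most \<open>\<kappa>\<close>\<close>

lemma maps_Mod_iff:
  "(M, \<pi>, N) \<in> maps (Mod L T) \<longleftrightarrow> M \<in> models L T \<and> N \<in> models L T \<and>
     substructure L M N \<and> \<pi> = restrict (\<lambda>x. x) (carrier M)"
  by (auto simp: Mod_def)

lemma worlds_Mod [simp]: "worlds (Mod L T) = models L T"
  by (simp add: Mod_def)

lemma ordLess_cardSuc_iff:
  assumes "Cinfinite \<kappa>"
  shows "|A| <o cardSuc \<kappa> \<longleftrightarrow> |A| \<le>o \<kappa>"
  using cardSuc_ordLeq_ordLess[OF _ card_of_Card_order[of A], of \<kappa>] assms by blast

lemma worlds_Mod_below:
  assumes "Cinfinite \<kappa>"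
  shows "worlds (Mod_below (cardSuc \<kappa>) L T) = {M \<in> models L T. |carrier M| \<le>o \<kappa>}"
  by (simp add: Mod_below_eq ordLess_cardSuc_iff[OF assms])

lemma maps_Mod_below_iff:
  assumes "Cinfinite \<kappa>"
  shows "(M, \<pi>, N) \<in> maps (Mod_below (cardSuc \<kappa>) L T) \<longleftrightarrow>
    M \<in> models L T \<and> N \<in> models L T \<and> |carrier M| \<le>o \<kappa> \<and> |carrier N| \<le>o \<kappa> \<and>
     substructure L M N \<and> \<pi> = restrict (\<lambda>x. x) (carrier M)"
  by (auto simp: Mod_below_eq ordLess_cardSuc_iff[OF assms])

text \<open>
  The relation \<open>R\<close> is the one described at the beginning; saturation and amalgamation
  serve its second clause. Infinite models of size below \<open>\<kappa>\<close> need not be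
  saturated, and that is why \<open>\<kappa>\<close>-small models are matched with themselves.
\<close>

lemma Mod_bisimilar_Mod_below:
  fixes L :: "('f, 'r) lang" and T :: "('f, 'r) fm set" and \<kappa> :: "'k rel"
  assumes T: "is_theory L T" and \<kappa>: "Cinfinite \<kappa>" and L: "|funs L| \<le>o \<kappa>" "|rels L| \<le>o \<kappa>"
    and sat: "\<And>M :: ('f, 'r, 'u) struct. M \<in> models L T \<Longrightarrow> |carrier M| =o \<kappa> \<Longrightarrow> aleph0_saturated L M"
    and consistent: "(models L T :: ('f, 'r, 'u) struct set) \<noteq> {}"
  shows "bitotally_bisimilar L (Mod L T :: ('f, 'r, 'u) psystem)
    (Mod_below (cardSuc \<kappa>) L T :: ('f, 'r, 'u) psystem)"
proof -
  let ?S = "Mod L T :: ('f, 'r, 'u) psystem"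
  let ?S' = "Mod_below (cardSuc \<kappa>) L T :: ('f, 'r, 'u) psystem"
  note below = worlds_Mod_below[OF \<kappa>] maps_Mod_below_iff[OF \<kappa>]
  have card: "Card_order \<kappa>" and inf\<kappa>: "infinite (Field \<kappa>)" using \<kappa> by (auto simp: cinfinite_def)
  define R where "R M a N b \<longleftrightarrow> M \<in> models L T \<and> N \<in> models L T \<and>
    set a \<subseteq> carrier M \<and> set b \<subseteq> carrier N \<and>
    (M = N \<and> a = b \<and> |carrier M| \<le>o \<kappa> \<or>
     \<kappa> \<le>o |carrier M| \<and> |carrier N| =o \<kappa> \<and> same_type L M a N b)"
    for M N :: "('f, 'r, 'u) struct" and a b
  have ne: "carrier M \<noteq> {}" if "M \<in> models L T" for M :: "('f, 'r, 'u) struct"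
    using that by (simp add: models_def is_struct_def)
  have str: "is_struct L M" if "M \<in> models L T" for M :: "('f, 'r, 'u) struct"
    using that by (simp add: models_def)
  have saturated: "aleph0_saturated L M" if "M \<in> models L T" "\<kappa> \<le>o |carrier M|"
    for M :: "('f, 'r, 'u) struct"
    by (rule aleph0_saturated_if_submodels[OF T \<kappa> L sat that])
  have R_total: "\<exists>K. X \<subseteq> carrier K \<and> |carrier K| \<le>o \<kappa> \<and> R M a K a \<and> (substructure L K M)"
    if M: "M \<in> models L T" and X: "X \<subseteq> carrier M" "|X| \<le>o \<kappa>" and a: "set a \<subseteq> X"
    for M :: "('f, 'r, 'u) struct" and X a
  proof (cases "|carrier M| \<le>o \<kappa>")
    case True
    then have "R M a M a" using M X a by (auto simp: R_def)
    moreover have "substructure L M M"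
      using str[OF M] by (auto simp: substructure_iff_is_emb is_emb_def inj_on_def)
    ultimately show ?thesis using X True by blast
  next
    case False
    then have large: "\<kappa> \<le>o |carrier M|"
      using card ordLeq_total[of \<kappa> "|carrier M|"] card_of_Well_order
      unfolding card_order_on_def by blast
    obtain K where K: "K \<in> models L T" "substructure L K M" "elementary L K M"
      "X \<subseteq> carrier K" "|carrier K| =o \<kappa>"
      by (rule elementary_submodel_of_card[OF T \<kappa> L M large X])
    have "same_type L M a K a"
      using same_type_elementary[OF K(3) ne[OF K(1)]] a K(4) same_type_sym by blast
    then have "R M a K a" using M K X a large by (auto simp: R_def)
    then show ?thesis using K ordIso_imp_ordLeq by blast
  qed
  have R_tuple: "\<exists>N b. R M a N b" if "M \<in> models L T" "set a \<subseteq> carrier M"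
    for M :: "('f, 'r, 'u) struct" and a
  proof -
    have "set a = (!) a ` {..<length a}" by (auto simp: set_conv_nth)
    then have "|set a| \<le>o \<kappa>" using card_image_ordLeq[OF countable_ordLeq[OF \<kappa>]] by metis
    then show ?thesis using R_total[OF that] by blast
  qed
  have "bisimulation L ?S ?S' R"
  proof (rule bisimulationI)
    show "\<exists>M a N b. R M a N b"
      using consistent R_tuple[of _ "[]"] by fastforce
  next
    fix M a N b assume R: "R M a N b"
    then have M: "M \<in> models L T" and N: "N \<in> models L T"
      and a: "set a \<subseteq> carrier M" and b: "set b \<subseteq> carrier N" by (auto simp: R_def)
    consider (eq) "M = N" "a = b" "|carrier M| \<le>o \<kappa>"
      | (type) "\<kappa> \<le>o |carrier M|" "|carrier N| =o \<kappa>" "same_type L M a N b"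
      using R by (auto simp: R_def)
    note cases = this
    have large_N: "\<kappa> \<le>o |carrier N|" if "|carrier N| =o \<kappa>"
      using that ordIso_iff_ordLeq by blast
    show "pointed ?S M a" using M a by (simp add: pointed_def)
    show "pointed ?S' N b"
      using cases N b by (auto simp: pointed_def below dest: ordIso_imp_ordLeq)
    show "length a = length b" using cases by (auto simp: same_type_def)
    show "sat_tuple M a \<phi> \<longleftrightarrow> sat_tuple N b \<phi>" if "\<phi> \<in> formulas L (length a)" "is_atomic \<phi>" for \<phi>
      using cases that by cases (auto simp: same_type_def)
    show "\<exists>d \<in> carrier N. R M (a @ [c]) N (b @ [d])" if c: "c \<in> carrier M" for c
      using cases
    proof cases
      case eq
      then show ?thesis using c M N a by (intro bexI[of _ c]) (auto simp: R_def)
    next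
      case type
      then obtain d where "d \<in> carrier N" "same_type L M (a @ [c]) N (b @ [d])"
        using same_type_realize[OF type(3) saturated[OF N large_N[OF type(2)]] ne[OF N] b c] by blast
      then show ?thesis using type c M N a b by (intro bexI[of _ d]) (auto simp: R_def)
    qed
    show "\<exists>c \<in> carrier M. R M (a @ [c]) N (b @ [d])" if d: "d \<in> carrier N" for d
      using cases
    proof cases
      case eq
      then show ?thesis using d M N a by (intro bexI[of _ d]) (auto simp: R_def)
    next
      case type
      then obtain c where "c \<in> carrier M" "same_type L N (b @ [d]) M (a @ [c])"
        using same_type_realize[OF same_type_sym[OF type(3)] saturated[OF M type(1)] ne[OF M] a d]
        by blast
      then have c: "c \<in> carrier M" "same_type L M (a @ [c]) N (b @ [d])"
        by (auto simp: same_type_def)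
      show ?thesis using c type d M N a b
        by (intro bexI[of _ c]) (auto simp: R_def)
    qed
    show "\<exists>\<rho> N'. (N, \<rho>, N') \<in> maps ?S' \<and> R M' (map \<pi> a) N' (map \<rho> b)"
      if "(M, \<pi>, M') \<in> maps ?S" for \<pi> M'
    proof -
      have M': "M' \<in> models L T" and sub: "substructure L M M'" and \<pi>: "map \<pi> a = a"
        using that map_restrict_id[OF a] by (auto simp: maps_Mod_iff)
      have MM': "carrier M \<subseteq> carrier M'" using sub by (simp add: substructure_def)
      from cases have "\<exists>N'. N' \<in> models L T \<and> |carrier N| \<le>o \<kappa> \<and> |carrier N'| \<le>o \<kappa> \<and>
        substructure L N N' \<and> R M' a N' b"
      proof cases
        case eq
        obtain K where K: "carrier M \<subseteq> carrier K" "|carrier K| \<le>o \<kappa>" "R M' a K a" "substructure L K M'"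
          using R_total[OF M' MM' eq(3) a] by blast
        then have "substructure L M K" using substructure_within[OF sub] by blast
        moreover have "K \<in> models L T" using K(3) by (simp add: R_def)
        ultimately show ?thesis using K eq by blast
      next
        case type
        have infN: "infinite (carrier N)"
          using type(2) \<kappa> card_of_ordIso_finite_Field[OF card] inf\<kappa> ordIso_symmetric by blast
        obtain N' where N': "substructure L N N'" "|carrier N'| =o |carrier N|" "same_type L M' a N' b"
          using extend_to_same_type[OF type(3) sub str[OF N] a b infN
              ordLeq_transitive[OF L(1) large_N[OF type(2)]]
              ordLeq_transitive[OF L(2) large_N[OF type(2)]]] by blast
        have "N' \<in> models L T"
          using models_same_type[OF T M' _ N'(3)] N'(1) by (simp add: substructure_def)
        moreover have "|carrier N'| =o \<kappa>" using N'(2) type(2) ordIso_transitive by blast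
        moreover have "\<kappa> \<le>o |carrier M'|"
          using type(1) ordLeq_transitive[OF _ card_of_mono1[OF MM']] by blast
        moreover have "set b \<subseteq> carrier N'" using b N'(1) by (auto simp: substructure_def)
        ultimately have "R M' a N' b" "N' \<in> models L T" "|carrier N'| \<le>o \<kappa>"
          using M' MM' a N'(3) ordIso_imp_ordLeq by (auto simp: R_def)
        then show ?thesis using N'(1) ordIso_imp_ordLeq[OF type(2)] by blast
      qed
      then obtain N' where N': "N' \<in> models L T" "|carrier N| \<le>o \<kappa>" "|carrier N'| \<le>o \<kappa>"
        "substructure L N N'" "R M' a N' b" by blast
      then have "(N, restrict (\<lambda>x. x) (carrier N), N') \<in> maps ?S'" using N by (simp add: below)
      then show ?thesis using N'(5) \<pi> map_restrict_id[OF b] by metis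
    qed
    show "\<exists>\<pi> M'. (M, \<pi>, M') \<in> maps ?S \<and> R M' (map \<pi> a) N' (map \<rho> b)"
      if "(N, \<rho>, N') \<in> maps ?S'" for \<rho> N'
    proof -
      have N': "N' \<in> models L T" "|carrier N'| \<le>o \<kappa>" and sub: "substructure L N N'"
        and \<rho>: "map \<rho> b = b"
        using that map_restrict_id[OF b] by (auto simp: below)
      have NN': "carrier N \<subseteq> carrier N'" using sub by (simp add: substructure_def)
      from cases have "\<exists>M'. M' \<in> models L T \<and> substructure L M M' \<and> R M' a N' b"
      proof cases
        case eq
        then have "R N' a N' b" using N' NN' a by (auto simp: R_def)
        then show ?thesis using N'(1) sub eq by blast
      next
        case type
        have infM: "infinite (carrier M)"
          using type(1) inf\<kappa> card_of_ordLeq_infinite[of "Field \<kappa>" "carrier M"]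
            card_of_Field_ordIso[OF card] ordIso_ordLeq_trans by blast
        obtain M' where M': "substructure L M M'" "|carrier M'| =o |carrier M|" "same_type L N' b M' a"
          using extend_to_same_type[OF same_type_sym[OF type(3)] sub str[OF M] b a infM
              ordLeq_transitive[OF L(1) type(1)] ordLeq_transitive[OF L(2) type(1)]] by blast
        have MM': "carrier M \<subseteq> carrier M'" using M'(1) by (simp add: substructure_def)
        have "M' \<in> models L T"
          using models_same_type[OF T N'(1) _ M'(3)] M'(1) by (simp add: substructure_def)
        moreover have "\<kappa> \<le>o |carrier N'|"
          using ordLeq_transitive[OF large_N[OF type(2)] card_of_mono1[OF NN']] .
        then have "|carrier N'| =o \<kappa>" using N'(2) by (simp add: ordIso_iff_ordLeq)
        moreover have "\<kappa> \<le>o |carrier M'|"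
          using ordLeq_transitive[OF type(1) card_of_mono1[OF MM']] .
        ultimately have "R M' a N' b" "M' \<in> models L T"
          using N' NN' MM' a b same_type_sym[OF M'(3)] by (auto simp: R_def)
        then show ?thesis using M'(1) by blast
      qed
      then obtain M' where "M' \<in> models L T" "substructure L M M'" "R M' a N' b" by blast
      then have "(M, restrict (\<lambda>x. x) (carrier M), M') \<in> maps ?S" "R M' a N' b"
        using M by (simp_all add: maps_Mod_iff)
      then show ?thesis using \<rho> map_restrict_id[OF a] by metis
    qed
  qed
  moreover have "bitotal ?S ?S' R"
    unfolding bitotal_def
  proof (intro conjI allI impI)
    fix M a assume "pointed ?S M a"
    then show "\<exists>N b. R M a N b" using R_tuple by (simp add: pointed_def)
  next
    fix N b assume "pointed ?S' N b"
    then have "R N b N b" by (simp add: R_def pointed_def below)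
    then show "\<exists>M a. R M a N b" by blast
  qed
  ultimately show ?thesis
    using potentialist_system_Mod potentialist_system_Mod_below
    unfolding bitotally_bisimilar_def by blast
qed

section \<open>A set-sized system\<close>

text \<open>
  All embeddings are admitted, not only inclusions: a model with domain \<open>A\<close> would
  otherwise have no proper extension.
\<close>

definition Mod_in :: "'u set \<Rightarrow> ('f, 'r) lang \<Rightarrow> ('f, 'r) fm set \<Rightarrow> ('f, 'r, 'u) psystem" where
  "Mod_in A L T = (let W = {M \<in> models L T. carrier M \<subseteq> A}
     in \<lparr>worlds = W, maps = {(M, \<pi>, N). M \<in> W \<and> N \<in> W \<and> embedding L M \<pi> N}\<rparr>)"

lemma worlds_Mod_in: "worlds (Mod_in A L T) = {M \<in> models L T. carrier M \<subseteq> A}"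
  by (simp add: Mod_in_def Let_def)

lemma maps_Mod_in_iff:
  "(M, \<pi>, N) \<in> maps (Mod_in A L T) \<longleftrightarrow>
    M \<in> worlds (Mod_in A L T) \<and> N \<in> worlds (Mod_in A L T) \<and> embedding L M \<pi> N"
  by (simp add: Mod_in_def Let_def)

lemma potentialist_system_Mod_in: "potentialist_system L (Mod_in A L T)"
  unfolding Mod_in_def Let_def by (rule potentialist_system_embeddings) (simp add: models_def)

lemma models_iso:
  assumes T: "is_theory L T" and M: "M \<in> models L T" and h: "is_emb L M h N" "h ` carrier M = carrier N"
    and N: "is_struct L N"
  shows "N \<in> models L T"
proof -
  have "closed_struct L M" using M is_struct_closed[of L M] by (simp add: models_def)
  then have "same_type L M [] N (map h [])" by (intro same_type_iso[OF h]) simp_all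
  then show ?thesis by (rule models_same_type[OF T M N])
qed

lemma copy_in:
  fixes M :: "('f, 'r, 'u) struct" and A :: "'u set"
  assumes T: "is_theory L T" and M: "M \<in> models L T" and card: "|carrier M| \<le>o |A|"
  obtains P h where "P \<in> models L T" "carrier P \<subseteq> A" "is_emb L M h P" "h ` carrier M = carrier P"
proof -
  have M_str: "is_struct L M" using M by (simp add: models_def)
  obtain h where h: "inj_on h (carrier M)" "h ` carrier M \<subseteq> A"
    using card card_of_ordLeq[of "carrier M" A] by blast
  have "|carrier M| <o |UNIV :: 'u set|" using M_str by (simp add: is_struct_def small_def)
  note P = image_struct[OF is_struct_closed[OF M_str] h(1) this]
  show thesis
  proof (rule that)
    show "image_struct L h M \<in> models L T" by (rule models_iso[OF T M P(2) _ P(1)]) simp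
  qed (use h P in auto)
qed

text \<open>
  The bisimulation relates models along isomorphisms. An inclusion \<open>M \<subseteq> M'\<close>
  is answered by the embedding of the copy of \<open>M\<close> into a copy of \<open>M'\<close> in
  \<open>A\<close>; an embedding of \<open>N\<close> is answered by an extension of
  \<open>M\<close> in the universe, where there is room outside \<open>M\<close>.
\<close>

lemma Mod_below_bisimilar_Mod_in:
  fixes L :: "('f, 'r) lang" and T :: "('f, 'r) fm set" and \<kappa> :: "'k rel" and A :: "'u set"
  assumes T: "is_theory L T" and \<kappa>: "Cinfinite \<kappa>" and A: "|A| =o \<kappa>" and U: "\<kappa> <o |UNIV :: 'u set|"
    and consistent: "worlds (Mod_below (cardSuc \<kappa>) L T :: ('f, 'r, 'u) psystem) \<noteq> {}"
  shows "bitotally_bisimilar L (Mod_below (cardSuc \<kappa>) L T :: ('f, 'r, 'u) psystem) (Mod_in A L T)"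
proof -
  let ?S = "Mod_below (cardSuc \<kappa>) L T :: ('f, 'r, 'u) psystem"
  let ?S' = "Mod_in A L T"
  note below = worlds_Mod_below[OF \<kappa>] maps_Mod_below_iff[OF \<kappa>]
  have card: "Card_order \<kappa>" and inf\<kappa>: "infinite (Field \<kappa>)" using \<kappa> by (auto simp: cinfinite_def)
  have U_inf: "infinite (UNIV :: 'u set)"
    using card_of_ordLeq_infinite[OF ordIso_ordLeq_trans[OF card_of_Field_ordIso[OF card]
          ordLess_imp_ordLeq[OF U]] inf\<kappa>] .
  have le_A: "|X| \<le>o |A|" if "|X| \<le>o \<kappa>" for X :: "'u set"
    using that A ordIso_symmetric ordLeq_ordIso_trans by blast
  have le_\<kappa>: "|X| \<le>o \<kappa>" if "X \<subseteq> A" for X :: "'u set"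
    using card_of_mono1[OF that] A ordLeq_ordIso_trans by blast
  have str: "is_struct L M" if "M \<in> models L T" for M :: "('f, 'r, 'u) struct"
    using that by (simp add: models_def)
  define R where "R M a N b \<longleftrightarrow> M \<in> worlds ?S \<and> N \<in> worlds ?S' \<and> set a \<subseteq> carrier M \<and>
    (\<exists>g. is_emb L M g N \<and> g ` carrier M = carrier N \<and> b = map g a)"
    for M N :: "('f, 'r, 'u) struct" and a b
  have R_total: "\<exists>N b. R M a N b" if "M \<in> worlds ?S" "set a \<subseteq> carrier M" for M a
  proof -
    have M: "M \<in> models L T" "|carrier M| \<le>o \<kappa>" using that by (auto simp: below)
    obtain P h where "P \<in> models L T" "carrier P \<subseteq> A" "is_emb L M h P" "h ` carrier M = carrier P"
      by (rule copy_in[OF T M(1) le_A[OF M(2)]])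
    then show ?thesis using that by (auto simp: R_def worlds_Mod_in)
  qed
  have "bisimulation L ?S ?S' R"
  proof (rule bisimulationI)
    show "\<exists>M a N b. R M a N b" using consistent R_total[of _ "[]"] by fastforce
  next
    fix M a N b assume R: "R M a N b"
    then obtain g where g: "is_emb L M g N" "g ` carrier M = carrier N" and b: "b = map g a"
      and M: "M \<in> models L T" "|carrier M| \<le>o \<kappa>" and N: "N \<in> models L T" "carrier N \<subseteq> A"
      and a: "set a \<subseteq> carrier M"
      by (auto simp: R_def below worlds_Mod_in)
    have M_cl: "closed_struct L M" and N_cl: "closed_struct L N"
      using M N str is_struct_closed by auto
    have inj: "inj_on g (carrier M)" using g by (simp add: is_emb_def)
    show "pointed ?S M a" using R by (simp add: R_def pointed_def)
    show "pointed ?S' N b" using R a g b by (auto simp: R_def pointed_def)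
    show "length a = length b" by (simp add: b)
    show "sat_tuple M a \<phi> \<longleftrightarrow> sat_tuple N b \<phi>" if "\<phi> \<in> formulas L (length a)" "is_atomic \<phi>" for \<phi>
      using sat_tuple_iso[OF g M_cl a that(1)] by (simp add: b)
    have R_snoc: "R M (a @ [c]) N (b @ [g c])" if "c \<in> carrier M" for c
      using R that g b unfolding R_def by (auto intro!: exI[of _ g])
    show "\<exists>d \<in> carrier N. R M (a @ [c]) N (b @ [d])" if "c \<in> carrier M" for c
      using R_snoc[OF that] that g(2) by blast
    show "\<exists>c \<in> carrier M. R M (a @ [c]) N (b @ [d])" if "d \<in> carrier N" for d
    proof -
      obtain c where "c \<in> carrier M" "d = g c" using \<open>d \<in> carrier N\<close> g(2) by auto
      then show ?thesis using R_snoc by blast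
    qed
    show "\<exists>\<rho> N'. (N, \<rho>, N') \<in> maps ?S' \<and> R M' (map \<pi> a) N' (map \<rho> b)"
      if "(M, \<pi>, M') \<in> maps ?S" for \<pi> M'
    proof -
      have M': "M' \<in> models L T" "|carrier M'| \<le>o \<kappa>" and sub: "substructure L M M'"
        and \<pi>: "map \<pi> a = a"
        using that map_restrict_id[OF a] by (auto simp: below)
      obtain N' k where N': "N' \<in> models L T" "carrier N' \<subseteq> A"
        and k: "is_emb L M' k N'" "k ` carrier M' = carrier N'"
        by (rule copy_in[OF T M'(1) le_A[OF M'(2)]])
      define \<rho> where "\<rho> = restrict (k \<circ> inv_into (carrier M) g) (carrier N)"
      have "is_emb L N (k \<circ> ((\<lambda>x. x) \<circ> inv_into (carrier M) g)) N'"
        using sub k by (intro is_emb_comp[OF is_emb_comp[OF is_emb_inv[OF g M_cl] _ N_cl] k(1) N_cl])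
          (simp add: substructure_iff_is_emb)
      then have "is_emb L N \<rho> N'"
        by (rule is_emb_cong[OF _ N_cl]) (simp add: \<rho>_def)
      then have "embedding L N \<rho> N'"
        using str N(1) N'(1) by (simp add: embedding_iff_is_emb \<rho>_def)
      then have "(N, \<rho>, N') \<in> maps ?S'" using N N' by (simp add: maps_Mod_in_iff worlds_Mod_in)
      moreover have "\<rho> (g c) = k c" if "c \<in> set a" for c
        using that a g(2) inj by (auto simp: \<rho>_def inv_into_f_f subset_iff)
      then have "map \<rho> b = map k a" by (simp add: b)
      moreover have "set a \<subseteq> carrier M'" using a sub by (auto simp: substructure_def)
      ultimately show ?thesis
        using M' N' k \<pi> unfolding R_def by (auto simp: below worlds_Mod_in)
    qed
    show "\<exists>\<pi> M'. (M, \<pi>, M') \<in> maps ?S \<and> R M' (map \<pi> a) N' (map \<rho> b)"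
      if "(N, \<rho>, N') \<in> maps ?S'" for \<rho> N'
    proof -
      have N': "N' \<in> models L T" "carrier N' \<subseteq> A" and \<rho>: "is_emb L N \<rho> N'"
        using that by (auto simp: maps_Mod_in_iff worlds_Mod_in embedding_iff_is_emb)
      have N'_cl: "closed_struct L N'" using N' str is_struct_closed by auto
      have N'_small: "|carrier N'| <o |UNIV :: 'u set|"
        using str[OF N'(1)] by (simp add: is_struct_def small_def)
      obtain M' k where M': "substructure L M M'" and k: "is_emb L N' k M'" "k ` carrier N' = carrier M'"
        and k_inv: "\<forall>c \<in> carrier M. k ((\<rho> \<circ> g) c) = c"
        by (rule extend_along_embedding[OF str[OF M(1)] N'_cl is_emb_comp[OF g(1) \<rho> M_cl] N'_small U_inf])
      let ?g = "inv_into (carrier N') k"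
      have inj_k: "inj_on k (carrier N')" using k(1) by (simp add: is_emb_def)
      have "?g c = \<rho> (g c)" if "c \<in> set a" for c
      proof (rule inv_into_f_eq[OF inj_k])
        have "g c \<in> carrier N" using that a g(2) by blast
        then show "\<rho> (g c) \<in> carrier N'" using \<rho> by (auto simp: is_emb_def)
        show "k (\<rho> (g c)) = c" using k_inv that a by auto
      qed
      then have map_eq: "map \<rho> b = map ?g a" by (simp add: b)
      have M'_str: "is_struct L M'" using M' by (simp add: substructure_def)
      have M'_model: "M' \<in> models L T" by (rule models_iso[OF T N'(1) k M'_str])
      have "|carrier M'| \<le>o \<kappa>" using card_image_ordLeq[OF le_\<kappa>[OF N'(2)], of k] k(2) by simp
      moreover have "set a \<subseteq> carrier M'" using a M' by (auto simp: substructure_def)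
      moreover have "?g ` carrier M' = carrier N'" using k(2) inj_k by (metis inv_into_image_cancel order_refl)
      ultimately have "R M' a N' (map \<rho> b)"
        using M'_model N' is_emb_inv[OF k N'_cl] map_eq unfolding R_def
        by (auto simp: below worlds_Mod_in)
      moreover have "(M, restrict (\<lambda>x. x) (carrier M), M') \<in> maps ?S"
        using M M' M'_model \<open>|carrier M'| \<le>o \<kappa>\<close> by (simp add: below)
      ultimately show ?thesis using map_restrict_id[OF a] by metis
    qed
  qed
  moreover have "bitotal ?S ?S' R"
    unfolding bitotal_def
  proof (intro conjI allI impI)
    fix M a assume "pointed ?S M a"
    then show "\<exists>N b. R M a N b" using R_total by (simp add: pointed_def)
  next
    fix N b assume N: "pointed ?S' N b"
    then have "N \<in> models L T" "carrier N \<subseteq> A" by (auto simp: pointed_def worlds_Mod_in)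
    then have "N \<in> worlds ?S" using le_\<kappa> by (simp add: below)
    moreover have "is_emb L N (\<lambda>x. x) N" by (auto simp: is_emb_def inj_on_def)
    ultimately have "R N b N b" using N unfolding R_def pointed_def by (auto intro!: exI[of _ "\<lambda>x. x"])
    then show "\<exists>M a. R M a N b" by blast
  qed
  ultimately show ?thesis
    using potentialist_system_Mod_in potentialist_system_Mod_below
    unfolding bitotally_bisimilar_def by blast
qed

text \<open>
  The default values in \<open>is_struct\<close> make a structure depend only on its domain and on
  the interpretations of the symbols of \<open>L\<close>.
\<close>

lemma is_struct_eqI:
  assumes "is_struct L M" "is_struct L N" "carrier M = carrier N"
    and "\<And>f xs. f \<in> funs L \<Longrightarrow> xs \<in> tuples (carrier M) (farity L f) \<Longrightarrow> fint M f xs = fint N f xs"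
    and "\<And>r xs. r \<in> rels L \<Longrightarrow> xs \<in> rint M r \<longleftrightarrow> xs \<in> rint N r"
  shows "M = N"
proof (rule struct.equality)
  show "fint M = fint N"
  proof (intro ext)
    fix f xs
    show "fint M f xs = fint N f xs"
      using assms unfolding is_struct_def by (metis (no_types, lifting))
  qed
  show "rint M = rint N"
  proof (intro ext set_eqI)
    fix r xs
    show "xs \<in> rint M r \<longleftrightarrow> xs \<in> rint N r"
      using assms(1,2,5) unfolding is_struct_def by (cases "r \<in> rels L") (metis empty_iff)+
  qed
qed (use assms in auto)

text \<open>
  A structure on a subset of \<open>A\<close> is determined by its domain, the graphs of its
  functions and its relations, which together form a subset of a set of size
  \<open>\<kappa>\<close>.
\<close>

lemma card_structs_on:
  fixes A :: "'u set" and L :: "('f, 'r) lang"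
  assumes \<kappa>: "Cinfinite \<kappa>" and L: "|funs L| \<le>o \<kappa>" "|rels L| \<le>o \<kappa>" and A: "|A| \<le>o \<kappa>"
  shows "|{M :: ('f, 'r, 'u) struct. is_struct L M \<and> carrier M \<subseteq> A}| \<le>o ctwo ^c \<kappa>"
proof -
  have inf: "infinite (Field \<kappa>)" and card: "Card_order \<kappa>" using \<kappa> by (auto simp: cinfinite_def)
  let ?W = "{M :: ('f, 'r, 'u) struct. is_struct L M \<and> carrier M \<subseteq> A}"
  let ?Z = "A <+> (funs L \<times> lists A \<times> A <+> rels L \<times> lists A)"
  define code where "code M = Inl ` carrier M \<union>
    (\<lambda>(f, xs). Inr (Inl (f, xs, fint M f xs))) ` (SIGMA f : funs L. tuples (carrier M) (farity L f)) \<union>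
    (\<lambda>(r, xs). Inr (Inr (r, xs))) ` (SIGMA r : rels L. rint M r)" for M :: "('f, 'r, 'u) struct"
  have "code M \<subseteq> ?Z" if M: "M \<in> ?W" for M
  proof -
    have M_str: "is_struct L M" and MA: "carrier M \<subseteq> A" using M by auto
    have tuple: "xs \<in> lists A" if "xs \<in> tuples (carrier M) n" for xs n
      using that MA by (auto simp: tuples_def in_lists_conv_set)
    have val: "fint M f xs \<in> A" if "f \<in> funs L" "xs \<in> tuples (carrier M) (farity L f)" for f xs
      using that MA is_struct_closed[OF M_str] by (auto simp: closed_struct_def)
    have rint: "rint M r \<subseteq> tuples (carrier M) (rarity L r)" if "r \<in> rels L" for r
      using that M_str unfolding is_struct_def by metis
    have "x \<in> ?Z" if "x \<in> code M" for x
    proof -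
      from that consider c where "x = Inl c" "c \<in> carrier M"
        | f xs where "x = Inr (Inl (f, xs, fint M f xs))" "f \<in> funs L"
            "xs \<in> tuples (carrier M) (farity L f)"
        | r xs where "x = Inr (Inr (r, xs))" "r \<in> rels L" "xs \<in> rint M r"
        unfolding code_def by (elim UnE imageE SigmaE) auto
      then show ?thesis
      proof cases
        case 1
        then show ?thesis using MA by auto
      next
        case 2
        then show ?thesis using tuple val by auto
      next
        case 3
        then show ?thesis using tuple[of xs "rarity L r"] rint[of r] by auto
      qed
    qed
    then show ?thesis by (rule subsetI)
  qed
  moreover have "inj_on code ?W"
  proof (rule inj_onI)
    fix M N assume MN: "M \<in> ?W" "N \<in> ?W" and eq: "code M = code N"
    have 1: "x \<in> carrier K \<longleftrightarrow> Inl x \<in> code K" for x K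
      by (auto simp: code_def)
    have 2: "xs \<in> tuples (carrier K) (farity L f) \<and> fint K f xs = y \<longleftrightarrow> Inr (Inl (f, xs, y)) \<in> code K"
      if "f \<in> funs L" for f xs y K
      using that by (auto simp: code_def image_iff)
    have 3: "xs \<in> rint K r \<longleftrightarrow> Inr (Inr (r, xs)) \<in> code K" if "r \<in> rels L" for r xs K
      using that by (auto simp: code_def image_iff)
    show "M = N"
    proof (rule is_struct_eqI[of L])
      show "carrier M = carrier N" using 1 eq by blast
      show "fint M f xs = fint N f xs" if "f \<in> funs L" "xs \<in> tuples (carrier M) (farity L f)" for f xs
        using 2[OF that(1), of xs M "fint M f xs"] 2[OF that(1), of xs N "fint M f xs"] that eq by simp
      show "xs \<in> rint M r \<longleftrightarrow> xs \<in> rint N r" if "r \<in> rels L" for r xs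
        using 3[OF that] eq by simp
    qed (use MN in auto)
  qed
  ultimately have W: "|?W| \<le>o |Pow ?Z|" by (intro card_of_ordLeqI) auto
  have "|?Z| \<le>o \<kappa>"
    by (intro card_of_Plus_ordLeq_infinite_Field[OF inf _ _ card]
        card_of_Times_ordLeq_infinite_Field[OF inf _ _ card] card_lists_ordLeq \<kappa> L A)
  then have "|?Z| \<le>o |Field \<kappa>|"
    using card_of_Field_ordIso[OF card] ordIso_symmetric ordLeq_ordIso_trans by blast
  then obtain h where h: "inj_on h ?Z" "h ` ?Z \<subseteq> Field \<kappa>"
    using card_of_ordLeq[of ?Z "Field \<kappa>"] by blast
  have "(`) h ` Pow ?Z \<subseteq> Pow (Field \<kappa>)"
  proof (rule image_subsetI)
    fix X assume "X \<in> Pow ?Z"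
    then have "h ` X \<subseteq> h ` ?Z" by (intro image_mono PowD)
    then have "h ` X \<subseteq> Field \<kappa>" using h(2) by (rule subset_trans)
    then show "h ` X \<in> Pow (Field \<kappa>)" by (rule PowI)
  qed
  then have "|Pow ?Z| \<le>o |Pow (Field \<kappa>)|"
    using card_of_ordLeq[of "Pow ?Z" "Pow (Field \<kappa>)"] inj_on_image_Pow[OF h(1)] by blast
  with W have "|?W| \<le>o |Pow (Field \<kappa>)|" by (rule ordLeq_transitive)
  also have "|Pow (Field \<kappa>)| =o ctwo ^c \<kappa>"
    using card_of_Pow_Func[of "Field \<kappa>"] by (simp add: cexp_def ctwo_def Field_card_of)
  finally show ?thesis .
qed

section \<open>The bisimilarity theorem\<close>

theorem theorem53:
  fixes L :: "('f, 'r) lang"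
    and T :: "('f, 'r) fm set"
    and \<kappa> :: "'k rel"
  assumes "is_theory L T"
    and "Card_order \<kappa>"
    and "ctwo ^c \<kappa> <o |UNIV :: 'u set|"
    and "rich TYPE('u) L T \<kappa>"
  shows "bitotally_bisimilar L (Mod L T :: ('f, 'r, 'u) psystem)
           (Mod_below (cardSuc \<kappa>) L T :: ('f, 'r, 'u) psystem) \<and>
         (\<exists>S :: ('f, 'r, 'u) psystem.
           set_sized S \<and> bitotally_bisimilar L (Mod L T :: ('f, 'r, 'u) psystem) S)"
proof -
  have rich: "|funs L <+> rels L| +c natLeq \<le>o \<kappa>"
    using assms(4) by (simp add: rich_def)
  obtain M :: "('f, 'r, 'u) struct" where M: "M \<in> models L T"
    using assms(4) by (auto simp: rich_def)
  have sat: "aleph0_saturated L M" if "M \<in> models L T" "|carrier M| =o \<kappa>"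
    for M :: "('f, 'r, 'u) struct"
    using assms(4) that by (simp add: rich_def)
  have "natLeq \<le>o \<kappa>"
    using ordLeq_csum2[OF natLeq_Card_order] rich ordLeq_transitive by blast
  then have \<kappa>: "Cinfinite \<kappa>" using cinfinite_mono natLeq_cinfinite assms(2) by blast
  have sum: "|funs L <+> rels L| \<le>o \<kappa>"
    using ordLeq_csum1[OF card_of_Card_order] rich ordLeq_transitive by blast
  have L: "|funs L| \<le>o \<kappa>" "|rels L| \<le>o \<kappa>"
    using ordLeq_transitive[OF card_of_Plus1 sum] ordLeq_transitive[OF card_of_Plus2 sum] by auto
  have U: "\<kappa> <o |UNIV :: 'u set|"
    using ordLess_ctwo_cexp[OF assms(2)] assms(3) ordLess_transitive by blast
  have part1: "bitotally_bisimilar L (Mod L T :: ('f, 'r, 'u) psystem)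
      (Mod_below (cardSuc \<kappa>) L T :: ('f, 'r, 'u) psystem)"
    by (rule Mod_bisimilar_Mod_below[OF assms(1) \<kappa> L sat]) (use M in auto)
  have "|Field \<kappa>| \<le>o |UNIV :: 'u set|"
    using card_of_Field_ordIso[OF assms(2)] ordLess_imp_ordLeq[OF U] ordIso_ordLeq_trans by blast
  from this[unfolded internalize_card_of_ordLeq2[of "Field \<kappa>" UNIV]]
  obtain A :: "'u set" where "|Field \<kappa>| =o |A|" by (elim exE conjE)
  then have A: "|A| =o \<kappa>"
    using card_of_Field_ordIso[OF assms(2)] ordIso_symmetric ordIso_transitive by blast
  obtain R where R: "bisimulation L (Mod L T :: ('f, 'r, 'u) psystem)
      (Mod_below (cardSuc \<kappa>) L T :: ('f, 'r, 'u) psystem) R"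
    using part1 unfolding bitotally_bisimilar_def by blast
  then obtain M a N b where "R M a N b" unfolding bisimulation_def by blast
  then have ne: "worlds (Mod_below (cardSuc \<kappa>) L T :: ('f, 'r, 'u) psystem) \<noteq> {}"
    using bisimulationD(2)[OF R] by (auto simp: pointed_def)
  have "bitotally_bisimilar L (Mod L T :: ('f, 'r, 'u) psystem) (Mod_in A L T)"
    by (rule bitotally_bisimilar_trans[OF part1
        Mod_below_bisimilar_Mod_in[OF assms(1) \<kappa> A U ne]])
  moreover have "set_sized (Mod_in A L T)"
  proof -
    have "|worlds (Mod_in A L T)| \<le>o |{M :: ('f, 'r, 'u) struct. is_struct L M \<and> carrier M \<subseteq> A}|"
      by (intro card_of_mono1) (auto simp: worlds_Mod_in models_def)
    also have "|{M :: ('f, 'r, 'u) struct. is_struct L M \<and> carrier M \<subseteq> A}| \<le>o ctwo ^c \<kappa>"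
      by (rule card_structs_on[OF \<kappa> L ordIso_imp_ordLeq[OF A]])
    finally show ?thesis unfolding set_sized_def using assms(3) ordLeq_ordLess_trans by blast
  qed
  ultimately show ?thesis using part1 by blast
qed

end
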